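(* Let $M$ be a complete, connected, $n$-dimensional Riemannian manifold and let $F=(f_1,\dots,f_m):M\to\mathbb{R}^m$ be continuously differentiable. Then the sequence $\{p^k\}$ generated by the steepest descent method with Armijo rule (described in the context), for any $\beta\in(0,1)$ and any starting point $p^0\in M$, is well defined. That is, at every iteration $k$ at which $p^k$ is not Pareto critical, the direction $v^k=v(p^k)$ exists and is uniquely determined, the steplength $t_k$ exists (the set whose maximum defines it is nonempty and its maximum is attained), and consequently $p^{k+1}\in M$ is well defined.
   Context: Notation: $I=\{1,\dots,m\}$; for $x,y\in\mathbb{R}^m$, $x\preceq y$ means $y_i-x_i\ge 0$ for all $i\in I$, and $x\prec y$ means $y_i-x_i>0$ for all $i\in I$; $\mathbb{R}^m_{++}=\{x\in\mathbb{R}^m: x_i>0,\ i\in I\}$. $\langle\cdot,\cdot\rangle$ and $\|\cdot\|$ denote the Riemannian metric and its norm, $\operatorname{grad} f_i$ the Riemannian gradient, $\exp_p:T_pM\to M$ the exponential map. For $p\in M$, $v\in T_pM$, $\operatorname{grad}F(p)v:=(\langle\operatorname{grad}f_1(p),v\rangle,\dots,\langle\operatorname{grad}f_m(p),v\rangle)\in\mathbb{R}^m$. A point $p\in M$ is Pareto critical for $F$ if $\{\operatorname{grad}F(p)v: v\in T_pM\}\cap(-\mathbb{R}^m_{++})=\emptyset$. The steepest descent direction of $F$ at $p$ is $$v(p):=\operatorname{argmin}_{v\in T_pM}\left\{\max_{i\in I}\langle\operatorname{grad}f_i(p),v\rangle+\tfrac12\|v\|^2\right\}\in T_pM.$$ Steepest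 descent method with Armijo rule: take $\beta\in(0,1)$ and $p^0\in M$. Given $p^k$: if $p^k$ is Pareto critical, stop. Otherwise set $v^k:=v(p^k)$, $$t_k:=\max\left\{2^{-j}: j\in\{0,1,2,\dots\},\ F(\exp_{p^k}(2^{-j}v^k))\preceq F(p^k)+\beta 2^{-j}\operatorname{grad}F(p^k)v^k\right\},$$ and $p^{k+1}:=\exp_{p^k}(t_kv^k)$. *)

theory Defs
  imports "HOL-Analysis.Analysis"
begin

text \<open>Used for open sets \<open>S\<close> only: the derivatives are taken in the ambient space.\<close>

primrec Ck_on :: "nat \<Rightarrow> ('a::real_normed_vector) set \<Rightarrow> ('a \<Rightarrow> 'b::real_normed_vector) \<Rightarrow> bool" where
  "Ck_on 0 S f \<longleftrightarrow> continuous_on S f"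
| "Ck_on (Suc k) S f \<longleftrightarrow>
     (\<forall>x\<in>S. f differentiable (at x)) \<and>
     (\<forall>v. Ck_on k S (\<lambda>x. frechet_derivative f (at x) v))"

definition smooth_on :: "('a::real_normed_vector) set \<Rightarrow> ('a \<Rightarrow> 'b::real_normed_vector) \<Rightarrow> bool" where
  "smooth_on S f \<longleftrightarrow> (\<forall>k. Ck_on k S f)"

text \<open>A chart is a pair of its domain and its coordinate map; the values of the map outside
  the domain are irrelevant. The dimension of the manifold is the cardinality of \<open>'n\<close>.\<close>

type_synonym ('a, 'n) chart = "'a set \<times> ('a \<Rightarrow> real ^ 'n)"

abbreviation dom_of :: "('a, 'n::finite) chart \<Rightarrow> 'a set" where
  "dom_of c \<equiv> fst c"

abbreviation coord :: "('a, 'n::finite) chart \<Rightarrow> 'a \<Rightarrow> real ^ 'n" where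
  "coord c \<equiv> snd c"

definition coord_inv :: "('a, 'n::finite) chart \<Rightarrow> real ^ 'n \<Rightarrow> 'a" where
  "coord_inv c = inv_into (dom_of c) (coord c)"

definition is_chart :: "'a topology \<Rightarrow> ('a, 'n::finite) chart \<Rightarrow> bool" where
  "is_chart M c \<longleftrightarrow>
     openin M (dom_of c) \<and> open (coord c ` dom_of c) \<and>
     homeomorphic_map (subtopology M (dom_of c)) (top_of_set (coord c ` dom_of c)) (coord c)"

text \<open>The atlas is not required to be maximal; all notions below depend only on the smooth
  structure it generates.\<close>

locale smooth_manifold =
  fixes M :: "'a topology" and A :: "('a, 'n::finite) chart set"
  assumes Hausdorff: "Hausdorff_space M"
    and second_countable: "second_countable M"
    and charts: "c \<in> A \<Longrightarrow> is_chart M c"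
    and cover: "(\<Union>c\<in>A. dom_of c) = topspace M"
    and transition: "\<lbrakk>c \<in> A; d \<in> A\<rbrakk> \<Longrightarrow>
      smooth_on (coord c ` (dom_of c \<inter> dom_of d)) (coord d \<circ> coord_inv c)"

definition C1_map ::
  "('a, 'n::finite) chart set \<Rightarrow> ('a \<Rightarrow> 'b::real_normed_vector) \<Rightarrow> bool" where
  "C1_map A f \<longleftrightarrow> (\<forall>c\<in>A. Ck_on 1 (coord c ` dom_of c) (f \<circ> coord_inv c))"

text \<open>A tangent vector at \<open>p\<close> is the family of its components with respect to all charts
  around \<open>p\<close>, related by the derivatives of the transition maps; that is, an equivalence class
  of triples \<open>(U, \<phi>, v)\<close>, represented as the function picking its unique representative in
  each chart. The components at all other arguments are set to zero.\<close>

type_synonym ('a, 'n) tangent = "('a, 'n) chart \<Rightarrow> real ^ 'n"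

definition tangent_space ::
  "('a, 'n::finite) chart set \<Rightarrow> 'a \<Rightarrow> ('a, 'n) tangent set" where
  "tangent_space A p =
     {v. (\<forall>c. \<not> (c \<in> A \<and> p \<in> dom_of c) \<longrightarrow> v c = 0) \<and>
         (\<forall>c\<in>A. \<forall>d\<in>A. p \<in> dom_of c \<inter> dom_of d \<longrightarrow>
            v d = frechet_derivative (coord d \<circ> coord_inv c) (at (coord c p)) (v c))}"

definition tangent_add ::
  "('a, 'n::finite) tangent \<Rightarrow> ('a, 'n) tangent \<Rightarrow> ('a, 'n) tangent" where
  "tangent_add v w = (\<lambda>c. v c + w c)"

definition tangent_scale ::
  "real \<Rightarrow> ('a, 'n::finite) tangent \<Rightarrow> ('a, 'n) tangent" where
  "tangent_scale a v = (\<lambda>c. a *\<^sub>R v c)"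

definition tangent_zero :: "('a, 'n::finite) tangent" where
  "tangent_zero = (\<lambda>c. 0)"

text \<open>The coordinate vector field \<open>\<partial>/\<partial>x\<^sub>i\<close> of the chart \<open>c\<close> at the point \<open>p\<close>.\<close>

definition coord_vector ::
  "('a, 'n::finite) chart set \<Rightarrow> ('a, 'n) chart \<Rightarrow> 'n \<Rightarrow> 'a \<Rightarrow> ('a, 'n) tangent" where
  "coord_vector A c i p =
     (\<lambda>d. if d \<in> A \<and> p \<in> dom_of d
          then frechet_derivative (coord d \<circ> coord_inv c) (at (coord c p)) (axis i 1)
          else 0)"

text \<open>The value \<open>df\<^sub>p(v)\<close>, which is the same in all charts around \<open>p\<close>.\<close>

definition differential ::
  "('a, 'n::finite) chart set \<Rightarrow> ('a \<Rightarrow> real) \<Rightarrow> 'a \<Rightarrow> ('a, 'n) tangent \<Rightarrow> real" where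
  "differential A f p v =
     (THE y. \<forall>c\<in>A. p \<in> dom_of c \<longrightarrow>
        y = frechet_derivative (f \<circ> coord_inv c) (at (coord c p)) (v c))"

definition velocity ::
  "('a, 'n::finite) chart set \<Rightarrow> (real \<Rightarrow> 'a) \<Rightarrow> real \<Rightarrow> ('a, 'n) tangent" where
  "velocity A \<gamma> t =
     (\<lambda>c. if c \<in> A \<and> \<gamma> t \<in> dom_of c then vector_derivative (coord c \<circ> \<gamma>) (at t) else 0)"

type_synonym ('a, 'n) metric = "'a \<Rightarrow> ('a, 'n) tangent \<Rightarrow> ('a, 'n) tangent \<Rightarrow> real"

definition metric_coeff ::
  "('a, 'n::finite) chart set \<Rightarrow> ('a, 'n) metric \<Rightarrow> ('a, 'n) chart \<Rightarrow> 'n \<Rightarrow> 'n \<Rightarrow> real ^ 'n \<Rightarrow> real"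
  where
  "metric_coeff A g c i j x =
     (let p = coord_inv c x in g p (coord_vector A c i p) (coord_vector A c j p))"

locale riemannian_manifold = smooth_manifold M A
  for M :: "'a topology" and A :: "('a, 'n::finite) chart set" +
  fixes g :: "('a, 'n) metric"
  assumes metric_sym:
      "\<lbrakk>p \<in> topspace M; v \<in> tangent_space A p; w \<in> tangent_space A p\<rbrakk> \<Longrightarrow> g p v w = g p w v"
    and metric_add:
      "\<lbrakk>p \<in> topspace M; u \<in> tangent_space A p; v \<in> tangent_space A p; w \<in> tangent_space A p\<rbrakk>
       \<Longrightarrow> g p (tangent_add u v) w = g p u w + g p v w"
    and metric_scale:
      "\<lbrakk>p \<in> topspace M; v \<in> tangent_space A p; w \<in> tangent_space A p\<rbrakk>
       \<Longrightarrow> g p (tangent_scale a v) w = a * g p v w"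
    and metric_pos:
      "\<lbrakk>p \<in> topspace M; v \<in> tangent_space A p; v \<noteq> tangent_zero\<rbrakk> \<Longrightarrow> 0 < g p v v"
    and metric_smooth:
      "c \<in> A \<Longrightarrow> smooth_on (coord c ` dom_of c) (metric_coeff A g c i j)"

definition riem_norm :: "('a, 'n::finite) metric \<Rightarrow> 'a \<Rightarrow> ('a, 'n) tangent \<Rightarrow> real" where
  "riem_norm g p v = sqrt (g p v v)"

definition riem_grad ::
  "('a, 'n::finite) chart set \<Rightarrow> ('a, 'n) metric \<Rightarrow> ('a \<Rightarrow> real) \<Rightarrow> 'a \<Rightarrow> ('a, 'n) tangent" where
  "riem_grad A g f p =
     (THE w. w \<in> tangent_space A p \<and> (\<forall>v\<in>tangent_space A p. g p w v = differential A f p v))"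

definition partial_deriv :: "'n::finite \<Rightarrow> (real ^ 'n \<Rightarrow> real) \<Rightarrow> real ^ 'n \<Rightarrow> real" where
  "partial_deriv i h x = frechet_derivative h (at x) (axis i 1)"

text \<open>The Christoffel symbols
  \<open>\<Gamma>\<^sup>k\<^sub>i\<^sub>j = 1/2 \<Sum>\<^sub>l g\<^sup>k\<^sup>l (\<partial>\<^sub>i g\<^sub>j\<^sub>l + \<partial>\<^sub>j g\<^sub>i\<^sub>l - \<partial>\<^sub>l g\<^sub>i\<^sub>j)\<close>
  of the Levi-Civita connection in the chart \<open>c\<close>.\<close>

definition christoffel ::
  "('a, 'n::finite) chart set \<Rightarrow> ('a, 'n) metric \<Rightarrow> ('a, 'n) chart \<Rightarrow>
   'n \<Rightarrow> 'n \<Rightarrow> 'n \<Rightarrow> real ^ 'n \<Rightarrow> real" where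
  "christoffel A g c k i j x =
     (1/2) * (\<Sum>l\<in>UNIV. matrix_inv (\<chi> a b. metric_coeff A g c a b x) $ k $ l *
        (partial_deriv i (metric_coeff A g c j l) x
         + partial_deriv j (metric_coeff A g c i l) x
         - partial_deriv l (metric_coeff A g c i j) x))"

text \<open>Geodesics \<open>\<gamma> : \<real> \<rightarrow> M\<close>: in every chart, the covariant acceleration vanishes,
  \<open>x\<^sub>k'' + \<Sum>\<^sub>i\<^sub>j \<Gamma>\<^sup>k\<^sub>i\<^sub>j x\<^sub>i' x\<^sub>j' = 0\<close>.\<close>

definition geodesic ::
  "'a topology \<Rightarrow> ('a, 'n::finite) chart set \<Rightarrow> ('a, 'n) metric \<Rightarrow> (real \<Rightarrow> 'a) \<Rightarrow> bool" where
  "geodesic M A g \<gamma> \<longleftrightarrow>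
     continuous_map euclideanreal M \<gamma> \<and>
     (\<forall>c\<in>A. \<forall>t. \<gamma> t \<in> dom_of c \<longrightarrow>
        (let x = coord c \<circ> \<gamma>; x' = (\<lambda>s. vector_derivative x (at s)) in
          x differentiable (at t) \<and>
          (x' has_vector_derivative
             (\<chi> k. - (\<Sum>i\<in>UNIV. \<Sum>j\<in>UNIV. christoffel A g c k i j (x t) * x' t $ i * x' t $ j)))
           (at t)))"

text \<open>Completeness means that geodesics with arbitrary initial data are defined on all of
  \<open>\<real>\<close>, so that the exponential map is defined on the whole of every tangent space.\<close>

definition geodesically_complete ::
  "'a topology \<Rightarrow> ('a, 'n::finite) chart set \<Rightarrow> ('a, 'n) metric \<Rightarrow> bool" where
  "geodesically_complete M A g \<longleftrightarrow>
     (\<forall>p\<in>topspace M. \<forall>v\<in>tangent_space A p. \<exists>\<gamma>. geodesic M A g \<gamma> \<and> \<gamma> 0 = p \<and> velocity A \<gamma> 0 = v)"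

definition riem_exp ::
  "'a topology \<Rightarrow> ('a, 'n::finite) chart set \<Rightarrow> ('a, 'n) metric \<Rightarrow> 'a \<Rightarrow> ('a, 'n) tangent \<Rightarrow> 'a"
  where
  "riem_exp M A g p v =
     (THE q. \<exists>\<gamma>. geodesic M A g \<gamma> \<and> \<gamma> 0 = p \<and> velocity A \<gamma> 0 = v \<and> \<gamma> 1 = q)"

definition grad_apply ::
  "('a, 'n::finite) chart set \<Rightarrow> ('a, 'n) metric \<Rightarrow> ('a \<Rightarrow> real ^ 'm::finite) \<Rightarrow>
   'a \<Rightarrow> ('a, 'n) tangent \<Rightarrow> real ^ 'm" where
  "grad_apply A g F p v = (\<chi> i. g p (riem_grad A g (\<lambda>q. F q $ i) p) v)"

definition pareto_critical ::
  "('a, 'n::finite) chart set \<Rightarrow> ('a, 'n) metric \<Rightarrow> ('a \<Rightarrow> real ^ 'm::finite) \<Rightarrow> 'a \<Rightarrow> bool" where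
  "pareto_critical A g F p \<longleftrightarrow>
     grad_apply A g F p ` tangent_space A p \<inter> uminus ` {x. \<forall>i. 0 < x $ i} = {}"

definition descent_objective ::
  "('a, 'n::finite) chart set \<Rightarrow> ('a, 'n) metric \<Rightarrow> ('a \<Rightarrow> real ^ 'm::finite) \<Rightarrow>
   'a \<Rightarrow> ('a, 'n) tangent \<Rightarrow> real" where
  "descent_objective A g F p v =
     (MAX i\<in>UNIV. g p (riem_grad A g (\<lambda>q. F q $ i) p) v) + (1/2) * (riem_norm g p v)\<^sup>2"

definition steepest_descent_direction ::
  "('a, 'n::finite) chart set \<Rightarrow> ('a, 'n) metric \<Rightarrow> ('a \<Rightarrow> real ^ 'm::finite) \<Rightarrow>
   'a \<Rightarrow> ('a, 'n) tangent" where
  "steepest_descent_direction A g F p =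
     arg_min (descent_objective A g F p) (\<lambda>v. v \<in> tangent_space A p)"

text \<open>The order on \<^typ>\<open>real ^ 'm\<close> is the componentwise one.\<close>

definition armijo_steps ::
  "'a topology \<Rightarrow> ('a, 'n::finite) chart set \<Rightarrow> ('a, 'n) metric \<Rightarrow> ('a \<Rightarrow> real ^ 'm::finite) \<Rightarrow>
   real \<Rightarrow> 'a \<Rightarrow> ('a, 'n) tangent \<Rightarrow> real set" where
  "armijo_steps M A g F \<beta> p v =
     {t. (\<exists>j::nat. t = (1/2) ^ j) \<and>
         F (riem_exp M A g p (tangent_scale t v)) \<le> F p + (\<beta> * t) *\<^sub>R grad_apply A g F p v}"

text \<open>\<open>GREATEST\<close> rather than \<open>Max\<close>, since the set of admissible steps is infinite in general.\<close>

definition armijo_step ::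
  "'a topology \<Rightarrow> ('a, 'n::finite) chart set \<Rightarrow> ('a, 'n) metric \<Rightarrow> ('a \<Rightarrow> real ^ 'm::finite) \<Rightarrow>
   real \<Rightarrow> 'a \<Rightarrow> ('a, 'n) tangent \<Rightarrow> real" where
  "armijo_step M A g F \<beta> p v = (GREATEST t. t \<in> armijo_steps M A g F \<beta> p v)"

definition next_point ::
  "'a topology \<Rightarrow> ('a, 'n::finite) chart set \<Rightarrow> ('a, 'n) metric \<Rightarrow> ('a \<Rightarrow> real ^ 'm::finite) \<Rightarrow>
   real \<Rightarrow> 'a \<Rightarrow> 'a" where
  "next_point M A g F \<beta> p =
     (let v = steepest_descent_direction A g F p
      in riem_exp M A g p (tangent_scale (armijo_step M A g F \<beta> p v) v))"

text \<open>The \<open>k\<close>-th iterate, or \<^const>\<open>None\<close> if the method has stopped before producing it.\<close>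

primrec iterate ::
  "'a topology \<Rightarrow> ('a, 'n::finite) chart set \<Rightarrow> ('a, 'n) metric \<Rightarrow> ('a \<Rightarrow> real ^ 'm::finite) \<Rightarrow>
   real \<Rightarrow> 'a \<Rightarrow> nat \<Rightarrow> 'a option" where
  "iterate M A g F \<beta> p0 0 = Some p0"
| "iterate M A g F \<beta> p0 (Suc k) =
     (case iterate M A g F \<beta> p0 k of
        None \<Rightarrow> None
      | Some p \<Rightarrow> if pareto_critical A g F p then None else Some (next_point M A g F \<beta> p))"

end

theory Submission
  imports Defs
begin

text \<open>An iteration of the method could fail at three places: the direction \<open>v(p)\<close> might not exist
or not be unique, no step might satisfy the Armijo inequality, and the exponential map might not
be defined.

The direction: read in a chart around \<open>p\<close>, the tangent space is \<open>\<real>\<^sup>n\<close> and the objective is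
a maximum of finitely many linear functions plus half of a positive definite quadratic form. It
is coercive and strictly convex, so it has exactly one minimizer (\<open>descent_direction_ex1\<close>).
If \<open>p\<close> is not Pareto critical, some direction makes all linear functions negative; a short
step along it gives the objective a negative value, hence its minimum is negative, and so are
all linear functions at the minimizer: \<open>v(p)\<close> is a descent direction for every component of
\<open>F\<close> (\<open>descent_direction_negative\<close>).

The step: along the geodesic \<open>\<gamma>(t) = exp\<^sub>p(t v)\<close> each component of \<open>F\<close> has the negative
derivative \<open>\<langle>grad f\<^sub>i(p), v\<rangle>\<close> at \<open>0\<close>. As \<open>\<beta> < 1\<close>, the Armijo
inequality only asks for a slope strictly less negative than that one, so it holds for all
small \<open>t > 0\<close>, in particular for some power of \<open>1/2\<close> (\<open>armijo_steps_nonempty\<close>). A nonempty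
set of powers of \<open>1/2\<close> with natural exponents has a largest element.

The exponential map: completeness provides a geodesic with prescribed initial data, but
\<open>exp\<^sub>p(v)\<close> is a well-defined point, and equal to \<open>\<gamma>(t)\<close> when \<open>v\<close> is
scaled by \<open>t\<close>, only because geodesics are determined by their initial data
(\<open>geodesic_unique\<close>). This is the main work. In a chart, position and velocity of a geodesic solve
an autonomous first-order equation. Its right-hand side is locally Lipschitz, because the
Christoffel symbols are built by sums, products and the inversion of a regular matrix from the
metric coefficients and their first partial derivatives, all of which are continuously
differentiable. Hence two geodesics that agree to first order at one time agree near that time.
Since \<open>M\<close> is Hausdorff, the set of times at which they disagree is open as well, and the
connectedness of \<open>\<real>\<close> makes local agreement global.\<close>

section \<open>Locally Lipschitz functions\<close>

text \<open>The estimate is required for all pairs of points close to \<open>x\<close>, that is, eventually in the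
neighbourhood filter of the point \<open>(x, x)\<close> of the diagonal. The radius of the neighbourhood
then never has to be named, and estimates for several functions are combined by the calculus of
filters.\<close>

definition lipschitz_near :: "('a::real_normed_vector \<Rightarrow> 'b::real_normed_vector) \<Rightarrow> 'a \<Rightarrow> bool" where
  "lipschitz_near f x \<longleftrightarrow>
     (\<exists>L. \<forall>\<^sub>F p in nhds (x, x). norm (f (fst p) - f (snd p)) \<le> L * norm (fst p - snd p))"

lemma lipschitz_nearE:
  assumes "lipschitz_near f x"
  obtains L where "0 < L"
    "\<forall>\<^sub>F p in nhds (x, x). norm (f (fst p) - f (snd p)) \<le> L * norm (fst p - snd p)"
proof -
  obtain L where L: "\<forall>\<^sub>F p in nhds (x, x). norm (f (fst p) - f (snd p)) \<le> L * norm (fst p - snd p)"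
    using assms by (auto simp: lipschitz_near_def)
  have "\<forall>\<^sub>F p in nhds (x, x). norm (f (fst p) - f (snd p)) \<le> (\<bar>L\<bar> + 1) * norm (fst p - snd p)"
    using L by eventually_elim (erule order_trans, intro mult_right_mono, auto)
  then show thesis
    by (rule that[rotated]) auto
qed

lemma eventually_nhds_diagonal:
  assumes "\<forall>\<^sub>F y in nhds x. P y"
  shows "\<forall>\<^sub>F p in nhds (x, x). P (fst p) \<and> P (snd p)"
proof -
  have "filterlim fst (nhds x) (nhds (x, x))" "filterlim snd (nhds x) (nhds (x, x))"
    using filterlim_fst[of "nhds x" "nhds x"] filterlim_snd[of "nhds x" "nhds x"]
    by (simp_all add: nhds_prod)
  then show ?thesis
    using assms by (auto simp: eventually_conj_iff filterlim_iff)
qed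

lemma lipschitz_near_continuous:
  assumes "lipschitz_near f x"
  shows "(f \<longlongrightarrow> f x) (nhds x)"
proof -
  obtain L where L: "\<forall>\<^sub>F p in nhds (x, x). norm (f (fst p) - f (snd p)) \<le> L * norm (fst p - snd p)"
    using assms by (auto simp: lipschitz_near_def)
  have "((\<lambda>y. (y, x)) \<longlongrightarrow> (x, x)) (nhds x)"
    by (intro tendsto_intros filterlim_ident)
  then have "\<forall>\<^sub>F y in nhds x. norm (f y - f x) \<le> L * norm (y - x)"
    using L by (auto simp: filterlim_iff)
  moreover have "((\<lambda>y. L * norm (y - x)) \<longlongrightarrow> 0) (nhds x)"
    by (rule tendsto_eq_intros filterlim_ident refl | simp)+
  ultimately have "((\<lambda>y. f y - f x) \<longlongrightarrow> 0) (nhds x)"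
    by (rule Lim_null_comparison)
  then show ?thesis
    by (simp add: LIM_zero_iff)
qed

text \<open>The increment of a product is estimated by those of the factors and by bounds for their values
near \<open>x\<close>, which continuity provides.\<close>

lemma lipschitz_near_bounded:
  assumes "lipschitz_near f x"
  obtains K where "0 < K" "\<forall>\<^sub>F p in nhds (x, x). norm (f (fst p)) \<le> K \<and> norm (f (snd p)) \<le> K"
proof
  have "((\<lambda>y. norm (f y)) \<longlongrightarrow> norm (f x)) (nhds x)"
    using lipschitz_near_continuous[OF assms] by (rule tendsto_norm)
  then have "\<forall>\<^sub>F y in nhds x. norm (f y) < norm (f x) + 1"
    by (rule order_tendstoD) simp
  then show "\<forall>\<^sub>F p in nhds (x, x). norm (f (fst p)) \<le> norm (f x) + 1 \<and> norm (f (snd p)) \<le> norm (f x) + 1"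
    by (intro eventually_nhds_diagonal) (auto elim!: eventually_mono)
qed (simp add: add_nonneg_pos)

lemma lipschitz_near_const: "lipschitz_near (\<lambda>_. c) x"
  by (auto simp: lipschitz_near_def intro!: exI[of _ 0])

lemma lipschitz_near_bounded_linear:
  assumes "bounded_linear f"
  shows "lipschitz_near f x"
proof -
  obtain K where "\<And>v. norm (f v) \<le> norm v * K"
    using bounded_linear.bounded[OF assms] by blast
  then show ?thesis
    by (auto simp: lipschitz_near_def linear_diff[OF bounded_linear.linear[OF assms], symmetric]
        mult.commute intro!: exI[of _ K] always_eventually)
qed

lemma lipschitz_near_cong:
  assumes "\<forall>\<^sub>F y in nhds x. f y = h y" "lipschitz_near h x"
  shows "lipschitz_near f x"
proof -
  obtain L where "\<forall>\<^sub>F p in nhds (x, x). norm (h (fst p) - h (snd p)) \<le> L * norm (fst p - snd p)"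
    using assms(2) by (auto simp: lipschitz_near_def)
  with eventually_nhds_diagonal[OF assms(1)]
  have "\<forall>\<^sub>F p in nhds (x, x). norm (f (fst p) - f (snd p)) \<le> L * norm (fst p - snd p)"
    by eventually_elim simp
  then show ?thesis
    by (auto simp: lipschitz_near_def)
qed

lemma lipschitz_near_add:
  assumes "lipschitz_near f x" "lipschitz_near h x"
  shows "lipschitz_near (\<lambda>y. f y + h y) x"
proof -
  obtain L1 L2 where
    "\<forall>\<^sub>F p in nhds (x, x). norm (f (fst p) - f (snd p)) \<le> L1 * norm (fst p - snd p)"
    "\<forall>\<^sub>F p in nhds (x, x). norm (h (fst p) - h (snd p)) \<le> L2 * norm (fst p - snd p)"
    using assms by (auto simp: lipschitz_near_def)
  then have "\<forall>\<^sub>F p in nhds (x, x). norm ((f (fst p) + h (fst p)) - (f (snd p) + h (snd p)))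
      \<le> (L1 + L2) * norm (fst p - snd p)"
    by eventually_elim (simp add: add_diff_add distrib_right norm_triangle_le)
  then show ?thesis
    by (auto simp: lipschitz_near_def)
qed

lemma lipschitz_near_sum:
  assumes "\<And>i. i \<in> I \<Longrightarrow> lipschitz_near (f i) x"
  shows "lipschitz_near (\<lambda>y. \<Sum>i\<in>I. f i y) x"
  using assms
  by (induction I rule: infinite_finite_induct) (auto intro: lipschitz_near_const lipschitz_near_add)

lemma lipschitz_near_mult:
  fixes f h :: "'a::real_normed_vector \<Rightarrow> real"
  assumes "lipschitz_near f x" "lipschitz_near h x"
  shows "lipschitz_near (\<lambda>y. f y * h y) x"
proof -
  obtain L1 where L1: "0 < L1"
    "\<forall>\<^sub>F p in nhds (x, x). norm (f (fst p) - f (snd p)) \<le> L1 * norm (fst p - snd p)"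
    using assms(1) by (rule lipschitz_nearE)
  obtain L2 where L2: "0 < L2"
    "\<forall>\<^sub>F p in nhds (x, x). norm (h (fst p) - h (snd p)) \<le> L2 * norm (fst p - snd p)"
    using assms(2) by (rule lipschitz_nearE)
  obtain K1 where K1: "0 < K1" "\<forall>\<^sub>F p in nhds (x, x). norm (f (fst p)) \<le> K1 \<and> norm (f (snd p)) \<le> K1"
    using assms(1) by (rule lipschitz_near_bounded)
  obtain K2 where K2: "0 < K2" "\<forall>\<^sub>F p in nhds (x, x). norm (h (fst p)) \<le> K2 \<and> norm (h (snd p)) \<le> K2"
    using assms(2) by (rule lipschitz_near_bounded)
  have "\<forall>\<^sub>F p in nhds (x, x). norm (f (fst p) * h (fst p) - f (snd p) * h (snd p))
      \<le> (L1 * K2 + K1 * L2) * norm (fst p - snd p)"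
    using L1(2) L2(2) K1(2) K2(2)
  proof eventually_elim
    case (elim p)
    have "norm (f (fst p) * h (fst p) - f (snd p) * h (snd p))
        = norm ((f (fst p) - f (snd p)) * h (fst p) + f (snd p) * (h (fst p) - h (snd p)))"
      by (simp add: algebra_simps)
    also have "\<dots> \<le> norm (f (fst p) - f (snd p)) * norm (h (fst p))
        + norm (f (snd p)) * norm (h (fst p) - h (snd p))"
      by (metis norm_mult norm_triangle_ineq)
    also have "\<dots> \<le> (L1 * norm (fst p - snd p)) * K2 + K1 * (L2 * norm (fst p - snd p))"
      using elim L1(1) L2(1) K1(1) K2(1) by (intro add_mono mult_mono) auto
    finally show ?case
      by (simp add: algebra_simps)
  qed
  then show ?thesis
    by (auto simp: lipschitz_near_def)
qed

lemma lipschitz_near_prod: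
  fixes f :: "'i \<Rightarrow> 'a::real_normed_vector \<Rightarrow> real"
  assumes "\<And>i. i \<in> I \<Longrightarrow> lipschitz_near (f i) x"
  shows "lipschitz_near (\<lambda>y. \<Prod>i\<in>I. f i y) x"
  using assms
  by (induction I rule: infinite_finite_induct) (auto intro: lipschitz_near_const lipschitz_near_mult)

lemma lipschitz_near_inverse:
  fixes f :: "'a::real_normed_vector \<Rightarrow> real"
  assumes "lipschitz_near f x" "f x \<noteq> 0"
  shows "lipschitz_near (\<lambda>y. inverse (f y)) x"
proof -
  obtain L where L: "0 < L"
    "\<forall>\<^sub>F p in nhds (x, x). norm (f (fst p) - f (snd p)) \<le> L * norm (fst p - snd p)"
    using assms(1) by (rule lipschitz_nearE)
  define r where "r = \<bar>f x\<bar> / 2"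
  have r: "0 < r"
    using assms(2) by (simp add: r_def)
  have "((\<lambda>y. \<bar>f y\<bar>) \<longlongrightarrow> \<bar>f x\<bar>) (nhds x)"
    using lipschitz_near_continuous[OF assms(1)] by (rule tendsto_rabs)
  then have "\<forall>\<^sub>F y in nhds x. r < \<bar>f y\<bar>"
    by (rule order_tendstoD) (use assms(2) in \<open>simp add: r_def\<close>)
  then have "\<forall>\<^sub>F p in nhds (x, x). r < \<bar>f (fst p)\<bar> \<and> r < \<bar>f (snd p)\<bar>"
    by (rule eventually_nhds_diagonal)
  with L(2) have "\<forall>\<^sub>F p in nhds (x, x). norm (inverse (f (fst p)) - inverse (f (snd p)))
      \<le> (L / (r * r)) * norm (fst p - snd p)"
  proof eventually_elim
    case (elim p)
    have nz: "f (fst p) \<noteq> 0" "f (snd p) \<noteq> 0"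
      using elim r by auto
    have "norm (inverse (f (fst p)) - inverse (f (snd p)))
        = norm (f (fst p) - f (snd p)) / (\<bar>f (fst p)\<bar> * \<bar>f (snd p)\<bar>)"
      using nz by (simp add: inverse_diff_inverse abs_mult divide_simps)
    also have "\<dots> \<le> (L * norm (fst p - snd p)) / (r * r)"
      using elim r by (intro frac_le mult_mono) auto
    finally show ?case
      by simp
  qed
  then show ?thesis
    unfolding lipschitz_near_def by blast
qed

lemma lipschitz_near_compose:
  assumes "lipschitz_near h x" "lipschitz_near f (h x)"
  shows "lipschitz_near (\<lambda>y. f (h y)) x"
proof -
  obtain L1 where L1: "0 < L1"
    "\<forall>\<^sub>F p in nhds (x, x). norm (h (fst p) - h (snd p)) \<le> L1 * norm (fst p - snd p)"
    using assms(1) by (rule lipschitz_nearE)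
  obtain L2 where L2: "0 < L2"
    "\<forall>\<^sub>F q in nhds (h x, h x). norm (f (fst q) - f (snd q)) \<le> L2 * norm (fst q - snd q)"
    using assms(2) by (rule lipschitz_nearE)
  have lim: "((\<lambda>p. h (fst p)) \<longlongrightarrow> h x) (nhds (x, x))" "((\<lambda>p. h (snd p)) \<longlongrightarrow> h x) (nhds (x, x))"
    using filterlim_compose[OF lipschitz_near_continuous[OF assms(1)] filterlim_fst[of _ "nhds x"]]
      filterlim_compose[OF lipschitz_near_continuous[OF assms(1)] filterlim_snd[of _ "nhds x"]]
    by (simp_all add: nhds_prod)
  have "((\<lambda>p. (h (fst p), h (snd p))) \<longlongrightarrow> (h x, h x)) (nhds (x, x))"
    by (intro tendsto_Pair lim)
  then have "\<forall>\<^sub>F p in nhds (x, x). norm (f (h (fst p)) - f (h (snd p)))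
      \<le> L2 * norm (h (fst p) - h (snd p))"
    using L2(2) by (auto simp: filterlim_iff)
  with L1(2) have "\<forall>\<^sub>F p in nhds (x, x). norm (f (h (fst p)) - f (h (snd p)))
      \<le> (L2 * L1) * norm (fst p - snd p)"
  proof eventually_elim
    case (elim p)
    have "L2 * norm (h (fst p) - h (snd p)) \<le> L2 * (L1 * norm (fst p - snd p))"
      using elim(1) L2(1) by (intro mult_left_mono) auto
    with elim(2) show ?case
      by (simp add: mult.assoc)
  qed
  then show ?thesis
    by (auto simp: lipschitz_near_def)
qed

lemma lipschitz_near_Pair:
  assumes "lipschitz_near f x" "lipschitz_near h x"
  shows "lipschitz_near (\<lambda>y. (f y, h y)) x"
proof -
  obtain L1 L2 where
    "\<forall>\<^sub>F p in nhds (x, x). norm (f (fst p) - f (snd p)) \<le> L1 * norm (fst p - snd p)"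
    "\<forall>\<^sub>F p in nhds (x, x). norm (h (fst p) - h (snd p)) \<le> L2 * norm (fst p - snd p)"
    using assms by (auto simp: lipschitz_near_def)
  then have "\<forall>\<^sub>F p in nhds (x, x). norm ((f (fst p), h (fst p)) - (f (snd p), h (snd p)))
      \<le> (L1 + L2) * norm (fst p - snd p)"
  proof eventually_elim
    case (elim p)
    then show ?case
      using norm_Pair_le[of "f (fst p) - f (snd p)" "h (fst p) - h (snd p)"]
      by (simp add: distrib_right)
  qed
  then show ?thesis
    by (auto simp: lipschitz_near_def)
qed

lemma lipschitz_near_vec:
  fixes f :: "'n::finite \<Rightarrow> 'a::real_normed_vector \<Rightarrow> real"
  assumes "\<And>k. lipschitz_near (f k) x"
  shows "lipschitz_near (\<lambda>y. \<chi> k. f k y) x"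
proof -
  have "\<exists>L. \<forall>k. \<forall>\<^sub>F p in nhds (x, x). norm (f k (fst p) - f k (snd p)) \<le> L k * norm (fst p - snd p)"
    using assms by (intro choice) (auto simp: lipschitz_near_def)
  then obtain L where
    "\<And>k. \<forall>\<^sub>F p in nhds (x, x). norm (f k (fst p) - f k (snd p)) \<le> L k * norm (fst p - snd p)"
    by blast
  then have "\<forall>\<^sub>F p in nhds (x, x). \<forall>k. norm (f k (fst p) - f k (snd p)) \<le> L k * norm (fst p - snd p)"
    by (rule eventually_all_finite)
  then have "\<forall>\<^sub>F p in nhds (x, x). norm ((\<chi> k. f k (fst p)) - (\<chi> k. f k (snd p)))
      \<le> (\<Sum>k\<in>UNIV. L k) * norm (fst p - snd p)"
  proof eventually_elim
    case (elim p)
    have "norm ((\<chi> k. f k (fst p)) - (\<chi> k. f k (snd p))) \<le> (\<Sum>k\<in>UNIV. \<bar>f k (fst p) - f k (snd p)\<bar>)"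
      using norm_le_l1_cart[of "(\<chi> k. f k (fst p)) - (\<chi> k. f k (snd p))"] by simp
    also have "\<dots> \<le> (\<Sum>k\<in>UNIV. L k * norm (fst p - snd p))"
      using elim by (intro sum_mono) simp
    finally show ?case
      by (simp add: sum_distrib_right)
  qed
  then show ?thesis
    by (auto simp: lipschitz_near_def)
qed

lemma lipschitz_near_det:
  fixes a :: "'n::finite \<Rightarrow> 'n \<Rightarrow> 'a::real_normed_vector \<Rightarrow> real"
  assumes "\<And>i j. lipschitz_near (a i j) x"
  shows "lipschitz_near (\<lambda>y. det (\<chi> i j. a i j y)) x"
  unfolding det_def
  by (auto intro!: lipschitz_near_sum lipschitz_near_mult lipschitz_near_const lipschitz_near_prod assms)

text \<open>Cramer's rule writes the entries of an inverse matrix as quotients of determinants, which are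
polynomials in the entries of the matrix; this reduces the Lipschitz property of the inverse
to that of sums, products and quotients.\<close>

lemma matrix_inv_entry:
  fixes G :: "real ^ 'n ^ 'n"
  assumes "det G \<noteq> 0"
  shows "matrix_inv G $ k $ l = det (\<chi> i j. if j = k then axis l 1 $ i else G $ i $ j) / det G"
proof -
  have "invertible G"
    using assms by (simp add: invertible_det_nz)
  then have "G ** matrix_inv G = mat 1"
    using someI_ex[of "\<lambda>H. G ** H = mat 1 \<and> H ** G = mat 1"]
    by (auto simp: invertible_def matrix_inv_def)
  then have "G *v column l (matrix_inv G) = axis l 1"
    by (metis matrix_vector_mul_assoc matrix_vector_mul_lid matrix_vector_mult_basis)
  then have "column l (matrix_inv G)
      = (\<chi> k. det (\<chi> i j. if j = k then axis l 1 $ i else G $ i $ j) / det G)"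
    using cramer[OF assms] by blast
  then show ?thesis
    by (simp add: column_def vec_eq_iff)
qed

lemma lipschitz_near_matrix_inv:
  fixes a :: "'n::finite \<Rightarrow> 'n \<Rightarrow> 'a::real_normed_vector \<Rightarrow> real"
  assumes "\<And>i j. lipschitz_near (a i j) x" and "det (\<chi> i j. a i j x) \<noteq> 0"
  shows "lipschitz_near (\<lambda>y. matrix_inv (\<chi> i j. a i j y) $ k $ l) x"
proof (rule lipschitz_near_cong)
  have det: "lipschitz_near (\<lambda>y. det (\<chi> i j. a i j y)) x"
    by (rule lipschitz_near_det) (rule assms)
  have "\<forall>\<^sub>F y in nhds x. det (\<chi> i j. a i j y) \<noteq> 0"
    using lipschitz_near_continuous[OF det] assms(2) by (rule tendsto_imp_eventually_ne)
  then show "\<forall>\<^sub>F y in nhds x. matrix_inv (\<chi> i j. a i j y) $ k $ l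
      = det (\<chi> i j. if j = k then axis l 1 $ i else a i j y) * inverse (det (\<chi> i j. a i j y))"
    by eventually_elim (simp add: matrix_inv_entry divide_inverse cong: if_cong)
  have "lipschitz_near (\<lambda>y. det (\<chi> i j. if j = k then axis l 1 $ i else a i j y)) x"
  proof (rule lipschitz_near_det)
    show "lipschitz_near (\<lambda>y. if j = k then axis l 1 $ i else a i j y) x" for i j
      using assms(1) by (cases "j = k") (simp_all add: lipschitz_near_const)
  qed
  then show "lipschitz_near (\<lambda>y. det (\<chi> i j. if j = k then axis l 1 $ i else a i j y)
      * inverse (det (\<chi> i j. a i j y))) x"
    using det assms(2) by (intro lipschitz_near_mult lipschitz_near_inverse)
qed

text \<open>On a compact ball the partial derivatives are bounded, which bounds the operator norm of the
derivative; the mean value inequality on the convex ball gives the Lipschitz estimate.\<close>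

lemma Ck_on_1_lipschitz_near:
  fixes f :: "'a::euclidean_space \<Rightarrow> real"
  assumes "Ck_on 1 S f" "open S" "x \<in> S"
  shows "lipschitz_near f x"
proof -
  have diff: "\<And>y. y \<in> S \<Longrightarrow> f differentiable (at y)"
    and cont: "\<And>v. continuous_on S (\<lambda>y. frechet_derivative f (at y) v)"
    using assms(1) by auto
  obtain e where e: "0 < e" "cball x e \<subseteq> S"
    using assms(2,3) open_contains_cball by blast
  have "\<exists>K. \<forall>y\<in>cball x e. \<bar>frechet_derivative f (at y) b\<bar> \<le> K" for b
  proof -
    have "compact ((\<lambda>y. frechet_derivative f (at y) b) ` cball x e)"
      by (rule compact_continuous_image[OF continuous_on_subset[OF cont e(2)] compact_cball])
    then have "bounded ((\<lambda>y. frechet_derivative f (at y) b) ` cball x e)"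
      by (rule compact_imp_bounded)
    then show ?thesis
      by (simp add: bounded_iff)
  qed
  then have "\<exists>K. \<forall>b. \<forall>y\<in>cball x e. \<bar>frechet_derivative f (at y) b\<bar> \<le> K b"
    by (intro choice) blast
  then obtain K where K: "\<And>b y. y \<in> cball x e \<Longrightarrow> \<bar>frechet_derivative f (at y) b\<bar> \<le> K b"
    by blast
  have onorm: "onorm (frechet_derivative f (at y)) \<le> (\<Sum>b\<in>Basis. K b)" if y: "y \<in> cball x e" for y
  proof (rule onorm_le)
    fix v
    have lin: "linear (frechet_derivative f (at y))"
      using diff e(2) y by (intro linear_frechet_derivative) auto
    have "frechet_derivative f (at y) v = frechet_derivative f (at y) (\<Sum>b\<in>Basis. (v \<bullet> b) *\<^sub>R b)"
      by (simp add: euclidean_representation)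
    also have "\<dots> = (\<Sum>b\<in>Basis. (v \<bullet> b) * frechet_derivative f (at y) b)"
      by (simp add: linear_sum[OF lin] linear_scale[OF lin])
    finally have "norm (frechet_derivative f (at y) v)
        \<le> (\<Sum>b\<in>Basis. \<bar>v \<bullet> b\<bar> * \<bar>frechet_derivative f (at y) b\<bar>)"
      using sum_abs[of "\<lambda>b. (v \<bullet> b) * frechet_derivative f (at y) b" Basis] by (simp add: abs_mult)
    also have "\<dots> \<le> (\<Sum>b\<in>Basis. norm v * K b)"
      using K[OF y] by (intro sum_mono mult_mono) (auto simp: Basis_le_norm)
    finally show "norm (frechet_derivative f (at y) v) \<le> (\<Sum>b\<in>Basis. K b) * norm v"
      by (simp add: sum_distrib_right mult.commute[of "norm v"])
  qed
  have "\<forall>\<^sub>F p in nhds (x, x). fst p \<in> cball x e \<and> snd p \<in> cball x e"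
    using e(1) by (intro eventually_nhds_diagonal)
      (auto intro: eventually_mono[OF eventually_nhds_ball])
  then have "\<forall>\<^sub>F p in nhds (x, x). norm (f (fst p) - f (snd p)) \<le> (\<Sum>b\<in>Basis. K b) * norm (fst p - snd p)"
  proof eventually_elim
    case (elim p)
    show ?case
    proof (rule differentiable_bound)
      show "(f has_derivative frechet_derivative f (at y)) (at y within cball x e)" if "y \<in> cball x e" for y
        using that diff e(2) frechet_derivative_works has_derivative_at_withinI by blast
    qed (use elim onorm in auto)
  qed
  then show ?thesis
    by (auto simp: lipschitz_near_def)
qed

section \<open>Local uniqueness for autonomous differential equations\<close>

text \<open>On an interval of radius \<open>h\<close> around \<open>t0\<close>, the difference \<open>u\<close> of two solutions with the
same value at \<open>t0\<close> has a derivative bounded by \<open>L\<close> times the maximum of \<open>|u|\<close>. By the mean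
value inequality this maximum is at most \<open>L h\<close> times itself, so it vanishes as soon as
\<open>L h < 1\<close>. The argument covers both time directions at once.\<close>

lemma ode_local_uniqueness:
  fixes f :: "'a::real_normed_vector \<Rightarrow> 'a" and z w :: "real \<Rightarrow> 'a"
  assumes f: "lipschitz_near f (z t0)"
    and z: "\<forall>\<^sub>F t in nhds t0. (z has_vector_derivative f (z t)) (at t)"
    and w: "\<forall>\<^sub>F t in nhds t0. (w has_vector_derivative f (w t)) (at t)"
    and init: "z t0 = w t0"
  shows "\<forall>\<^sub>F t in nhds t0. z t = w t"
proof -
  obtain L where L: "0 < L"
    "\<forall>\<^sub>F p in nhds (z t0, z t0). norm (f (fst p) - f (snd p)) \<le> L * norm (fst p - snd p)"
    using f by (rule lipschitz_nearE)
  have cont: "isCont z t0" "isCont w t0"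
    using eventually_nhds_x_imp_x[OF z] eventually_nhds_x_imp_x[OF w]
    by (auto intro: has_vector_derivative_continuous)
  then have "(z \<longlongrightarrow> z t0) (nhds t0)" "(w \<longlongrightarrow> w t0) (nhds t0)"
    by (simp_all only: isCont_def tendsto_at_iff_tendsto_nhds)
  then have "((\<lambda>t. (z t, w t)) \<longlongrightarrow> (z t0, z t0)) (nhds t0)"
    unfolding init by (rule tendsto_Pair)
  then have "\<forall>\<^sub>F t in nhds t0. norm (f (z t) - f (w t)) \<le> L * norm (z t - w t)"
    using L(2) by (auto simp: filterlim_iff)
  then have "\<forall>\<^sub>F t in nhds t0. norm (f (z t) - f (w t)) \<le> L * norm (z t - w t)
      \<and> (z has_vector_derivative f (z t)) (at t) \<and> (w has_vector_derivative f (w t)) (at t)"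
    using z w by eventually_elim simp
  then obtain e where e: "0 < e" and
    near: "\<And>t. dist t t0 < e \<Longrightarrow> norm (f (z t) - f (w t)) \<le> L * norm (z t - w t)
      \<and> (z has_vector_derivative f (z t)) (at t) \<and> (w has_vector_derivative f (w t)) (at t)"
    unfolding eventually_nhds_metric by blast
  \<comment> \<open>The radius stays below \<open>e\<close>, where the estimates hold, and makes \<open>L * h\<close> at most \<open>1/2\<close>.\<close>
  define h where "h = min (e / 2) (1 / (2 * L))"
  have h: "0 < h" "h < e" "L * h \<le> 1 / 2"
    using e L(1) by (auto simp: h_def min_def field_simps)
  define u where "u t = z t - w t" for t
  have I: "dist t t0 < e" if "t \<in> cball t0 h" for t
    using that h(2) by (simp add: dist_commute)
  have u: "(u has_vector_derivative f (z t) - f (w t)) (at t)" if "t \<in> cball t0 h" for t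
    unfolding u_def using near[OF I[OF that]] by (intro derivative_intros) auto
  have "continuous_on (cball t0 h) (\<lambda>t. norm (u t))"
    by (intro continuous_on_norm continuous_at_imp_continuous_on ballI
        has_vector_derivative_continuous[OF u])
  then obtain s where s: "s \<in> cball t0 h" "\<And>t. t \<in> cball t0 h \<Longrightarrow> norm (u t) \<le> norm (u s)"
    using continuous_attains_sup[of "cball t0 h" "\<lambda>t. norm (u t)"] h(1) by auto
  have "norm (u s - u t0) \<le> (L * norm (u s)) * norm (s - t0)"
  proof (rule differentiable_bound[of "cball t0 h"])
    show "(u has_derivative (\<lambda>r. r *\<^sub>R (f (z t) - f (w t)))) (at t within cball t0 h)"
      if "t \<in> cball t0 h" for t
      using u[OF that] has_derivative_at_withinI unfolding has_vector_derivative_def by blast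
    show "onorm (\<lambda>r. r *\<^sub>R (f (z t) - f (w t))) \<le> L * norm (u s)" if t: "t \<in> cball t0 h" for t
    proof (rule onorm_le)
      fix r :: real
      have "norm (f (z t) - f (w t)) \<le> L * norm (u s)"
        using near[OF I[OF t]] mult_left_mono[OF s(2)[OF t], of L] L(1)
        by (auto simp: u_def intro: order_trans)
      then show "norm (r *\<^sub>R (f (z t) - f (w t))) \<le> L * norm (u s) * norm r"
        by (simp add: mult.commute mult_left_mono)
    qed
  qed (use s h(1) in auto)
  also have "\<dots> \<le> (L * norm (u s)) * h"
    using s(1) L(1) by (intro mult_left_mono) (auto simp: dist_norm norm_minus_commute)
  also have "\<dots> \<le> norm (u s) * (1 / 2)"
    using mult_left_mono[OF h(3) norm_ge_zero[of "u s"]] by (simp add: algebra_simps)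
  finally have "norm (u s) = 0"
    using init by (simp add: u_def)
  then have "u t = 0" if "t \<in> cball t0 h" for t
    using s(2)[OF that] by simp
  then have "z t = w t" if "dist t t0 < h" for t
    using that by (simp add: u_def dist_commute less_imp_le)
  then show ?thesis
    using h(1) unfolding eventually_nhds_metric by blast
qed

section \<open>Positive definite forms\<close>

locale pos_def_form =
  fixes B :: "'a::euclidean_space \<Rightarrow> 'a \<Rightarrow> real"
  assumes bilinear: "bilinear B"
    and pos: "x \<noteq> 0 \<Longrightarrow> 0 < B x x"
begin

lemma linear_right: "linear (B x)" and linear_left: "linear (\<lambda>x. B x y)"
  using bilinear by (auto simp: bilinear_def)

lemma add_left: "B (x + y) z = B x z + B y z"
  and add_right: "B x (y + z) = B x y + B x z"
  and diff_left: "B (x - y) z = B x z - B y z"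
  and diff_right: "B x (y - z) = B x y - B x z"
  and scale_left: "B (r *\<^sub>R x) y = r * B x y"
  and scale_right: "B x (r *\<^sub>R y) = r * B x y"
  and zero_left: "B 0 x = 0"
  using linear_add[OF linear_left] linear_add[OF linear_right]
    linear_diff[OF linear_left] linear_diff[OF linear_right]
    linear_scale[OF linear_left] linear_scale[OF linear_right]
    linear_0[OF linear_left]
  by simp_all

lemma nonneg: "0 \<le> B x x"
  using pos[of x] zero_left by (cases "x = 0") auto

lemma continuous_quadratic: "continuous_on S (\<lambda>x. B x x)"
proof -
  have "bounded_bilinear B"
    using bilinear by (simp add: bilinear_conv_bounded_bilinear)
  then show ?thesis
    by (rule bounded_bilinear.continuous_on) (rule continuous_on_id)+
qed

text \<open>By homogeneity it suffices to bound the quadratic form from below on the unit sphere, which is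
compact.\<close>

lemma coercive: "\<exists>c>0. \<forall>x. c * (norm x)\<^sup>2 \<le> B x x"
proof -
  have "sphere (0::'a) 1 \<noteq> {}"
    by simp
  then obtain u where u: "u \<in> sphere 0 1" "\<And>x. x \<in> sphere 0 1 \<Longrightarrow> B u u \<le> B x x"
    using continuous_attains_inf[OF compact_sphere _ continuous_quadratic] by blast
  have "B u u * (norm x)\<^sup>2 \<le> B x x" for x
  proof (cases "x = 0")
    case False
    then have "B u u \<le> B ((1 / norm x) *\<^sub>R x) ((1 / norm x) *\<^sub>R x)"
      by (intro u(2)) simp
    also have "\<dots> = B x x / (norm x)\<^sup>2"
      by (simp add: scale_left scale_right power2_eq_square)
    finally show ?thesis
      using False by (simp add: field_simps)
  qed (simp add: zero_left)
  moreover have "0 < B u u"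
    using u(1) by (intro pos) auto
  ultimately show ?thesis
    by blast
qed

text \<open>Sending \<open>a\<close> to the functional \<open>B a\<close> is injective by definiteness, hence bijective because the
dimension is finite. The functional is encoded by the vector of its values on the basis, so
that this becomes a statement about an endomorphism.\<close>

lemma riesz:
  assumes "linear l"
  shows "\<exists>!a. \<forall>x. B a x = l x"
proof (rule ex_ex1I)
  define T where "T a = (\<Sum>b\<in>Basis. B a b *\<^sub>R b)" for a
  have T: "T a \<bullet> b = B a b" if "b \<in> Basis" for a b
    using that by (simp add: T_def inner_sum_left_Basis)
  have "linear T"
    by (rule linearI) (simp_all add: T_def add_left scale_left scaleR_add_left sum.distrib scaleR_sum_right)
  moreover have "inj T"
  proof (subst linear_injective_0[OF \<open>linear T\<close>], safe)
    fix a assume "T a = 0"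
    then have "B a b = 0" if "b \<in> Basis" for b
      using T[OF that, of a] by simp
    then have "B a = (\<lambda>_. 0)"
      by (intro linear_eq_stdbasis[OF linear_right linear_zero]) simp
    then show "a = 0"
      using pos[of a] by force
  qed
  ultimately have "surj T"
    by (rule eucl.linear_inj_imp_surj)
  then obtain a where a: "T a = (\<Sum>b\<in>Basis. l b *\<^sub>R b)"
    by (metis surjD)
  have "B a b = l b" if "b \<in> Basis" for b
    using that T[OF that, of a] by (simp add: a inner_sum_left_Basis)
  then have "B a = l"
    by (intro linear_eq_stdbasis[OF linear_right assms]) simp
  then show "\<exists>a. \<forall>x. B a x = l x"
    by auto
next
  fix a a' assume "\<forall>x. B a x = l x" "\<forall>x. B a' x = l x"
  then have "B (a - a') (a - a') = 0"
    by (simp add: diff_left)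
  then show "a = a'"
    using pos[of "a - a'"] by force
qed

text \<open>The objective whose minimizer is the steepest descent direction, as a function on a vector
space.\<close>

definition max_plus_quadratic :: "('i::finite \<Rightarrow> 'a \<Rightarrow> real) \<Rightarrow> 'a \<Rightarrow> real" where
  "max_plus_quadratic l x = (MAX i. l i x) + 1 / 2 * B x x"

context
  fixes l :: "'i::finite \<Rightarrow> 'a \<Rightarrow> real"
  assumes linear: "linear (l i)"
begin

lemma max_attained: obtains i where "(MAX i. l i x) = l i x"
proof -
  have "(MAX i. l i x) \<in> range (\<lambda>i. l i x)"
    by (rule Max_in) simp_all
  then show thesis
    by (elim rangeE) (rule that)
qed

lemma max_ge: "l i x \<le> (MAX i. l i x)"
  by simp

lemma max_plus_quadratic_0: "max_plus_quadratic l 0 = 0"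
  by (simp add: max_plus_quadratic_def linear_0[OF linear] zero_left)

lemma continuous_linear_part: "continuous_on S (l i)"
  by (simp add: linear_continuous_on linear_conv_bounded_linear[symmetric] linear)

lemma continuous_max_plus_quadratic: "continuous_on S (max_plus_quadratic l)"
proof -
  have "continuous_on S (\<lambda>x. Max ((\<lambda>i. l i x) ` I))" if "finite I" "I \<noteq> {}" for I
    using that
  proof (induction I rule: finite_ne_induct)
    case (singleton i)
    show ?case
      by (simp add: continuous_linear_part)
  next
    case (insert i I)
    then have "continuous_on S (\<lambda>x. max (l i x) (Max ((\<lambda>i. l i x) ` I)))"
      by (intro continuous_on_max continuous_linear_part)
    with insert.hyps show ?case
      by simp
  qed
  then show ?thesis
    unfolding max_plus_quadratic_def
    by (intro continuous_intros continuous_quadratic) simp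
qed

text \<open>Strict convexity at midpoints, which is all that uniqueness of minimizers needs: the maximum of
linear functions is convex, and the parallelogram identity supplies the strict gain
\<open>B (x - y) (x - y) / 8\<close>.\<close>

lemma max_plus_quadratic_midpoint:
  assumes "x \<noteq> y"
  shows "max_plus_quadratic l ((1 / 2) *\<^sub>R (x + y))
    < (max_plus_quadratic l x + max_plus_quadratic l y) / 2"
proof -
  let ?z = "(1 / 2) *\<^sub>R (x + y)"
  obtain i where i: "(MAX i. l i ?z) = l i ?z"
    by (rule max_attained)
  have "l i ?z = (l i x + l i y) / 2"
    by (simp add: linear_scale[OF linear] linear_add[OF linear])
  then have "(MAX i. l i ?z) \<le> ((MAX i. l i x) + (MAX i. l i y)) / 2"
    unfolding i using max_ge[of i x] max_ge[of i y] by argo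
  moreover have "B ?z ?z = (B x x + B y y) / 2 - B (x - y) (x - y) / 4"
    by (simp add: add_left add_right diff_left diff_right scale_left scale_right field_simps)
  moreover have "0 < B (x - y) (x - y)"
    using assms by (intro pos) simp
  ultimately show ?thesis
    unfolding max_plus_quadratic_def by argo
qed

text \<open>Bounding the maximum below by a single linear function, the objective is at least
\<open>c/2 |y|\<^sup>2 - K |y|\<close>, hence nonnegative outside the ball of radius \<open>2 K / c\<close>. As its value at
\<open>0\<close> is \<open>0\<close>, a minimizer on this ball is a global one.\<close>

lemma max_plus_quadratic_ex1_arg_min:
  "\<exists>!x. is_arg_min (max_plus_quadratic l) (\<lambda>_. True) x"
proof (rule ex_ex1I)
  obtain c where c: "0 < c" "\<And>x. c * (norm x)\<^sup>2 \<le> B x x"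
    using coercive by blast
  \<comment> \<open>Any index will do; the index type is inhabited.\<close>
  obtain i :: 'i where True
    by simp
  obtain K where K: "0 < K" "\<And>x. norm (l i x) \<le> norm x * K"
    using bounded_linear.pos_bounded linear_conv_bounded_linear linear by blast
  have "cball (0::'a) (2 * K / c) \<noteq> {}"
    using c(1) K(1) by (simp add: not_less)
  then obtain x where x: "\<And>y. y \<in> cball 0 (2 * K / c) \<Longrightarrow> max_plus_quadratic l x \<le> max_plus_quadratic l y"
    using continuous_attains_inf[OF compact_cball _ continuous_max_plus_quadratic] by blast
  have "max_plus_quadratic l x \<le> max_plus_quadratic l y" for y
  proof (cases "y \<in> cball 0 (2 * K / c)")
    case False
    then have "2 * K \<le> c * norm y"
      using c(1) by (simp add: field_simps)
    then have "2 * K * norm y \<le> c * (norm y)\<^sup>2"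
      using mult_right_mono[of "2 * K" "c * norm y" "norm y"] by (simp add: power2_eq_square mult.assoc)
    then have "0 \<le> l i y + 1 / 2 * B y y"
      using K(2)[of y] c(2)[of y] abs_le_D2[of "l i y"] by (simp add: algebra_simps)
    also have "\<dots> \<le> max_plus_quadratic l y"
      using max_ge[of i y] by (simp add: max_plus_quadratic_def)
    finally show ?thesis
      using x[of 0] c(1) K(1) by (simp add: max_plus_quadratic_0)
  qed (rule x)
  then show "\<exists>x. is_arg_min (max_plus_quadratic l) (\<lambda>_. True) x"
    by (auto simp: is_arg_min_linorder)
next
  fix x y
  assume "is_arg_min (max_plus_quadratic l) (\<lambda>_. True) x" "is_arg_min (max_plus_quadratic l) (\<lambda>_. True) y"
  then have "max_plus_quadratic l x \<le> max_plus_quadratic l z" "max_plus_quadratic l y \<le> max_plus_quadratic l z" for z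
    by (auto simp: is_arg_min_linorder)
  from this[of "(1 / 2) *\<^sub>R (x + y)"] show "x = y"
    using max_plus_quadratic_midpoint[of x y] by argo
qed

text \<open>Along \<open>s w\<close> the objective is at most \<open>s \<mu> + s\<^sup>2 B w w / 2\<close>, where
\<open>\<mu> < 0\<close> is the maximum of the linear functions at \<open>w\<close>. Hence the minimum is negative; since
the quadratic part is nonnegative, the linear functions at the minimizer have to be negative.\<close>

lemma arg_min_descends:
  assumes x: "is_arg_min (max_plus_quadratic l) (\<lambda>_. True) x" and w: "\<And>i. l i w < 0"
  shows "l i x < 0"
proof -
  define \<mu> where "\<mu> = (MAX i. l i w)"
  obtain j where "\<mu> = l j w"
    unfolding \<mu>_def by (rule max_attained)
  then have \<mu>: "\<mu> < 0"
    using w by simp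
  have "w \<noteq> 0"
    using w linear_0[OF linear] by force
  then have q: "0 < B w w"
    by (rule pos)
  \<comment> \<open>The step that minimizes the quadratic bound.\<close>
  define s where "s = - \<mu> / B w w"
  have s: "0 < s"
    using \<mu> q by (simp add: s_def divide_neg_pos)
  obtain k where "(MAX i. l i (s *\<^sub>R w)) = l k (s *\<^sub>R w)"
    by (rule max_attained)
  then have "(MAX i. l i (s *\<^sub>R w)) \<le> s * \<mu>"
    using max_ge[of k w] s by (simp add: linear_scale[OF linear] \<mu>_def)
  then have "max_plus_quadratic l (s *\<^sub>R w) \<le> s * \<mu> + 1 / 2 * (s * (s * B w w))"
    by (simp add: max_plus_quadratic_def scale_left scale_right)
  also have "s * B w w = - \<mu>"
    using q by (simp add: s_def)
  finally have "max_plus_quadratic l (s *\<^sub>R w) \<le> s * \<mu> / 2"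
    by (simp add: mult.commute)
  also have "\<dots> < 0"
    using s \<mu> by (simp add: mult_pos_neg)
  finally have "max_plus_quadratic l x < 0"
    using x by (auto simp: is_arg_min_linorder intro: le_less_trans)
  then show ?thesis
    using max_ge[of i x] nonneg[of x] unfolding max_plus_quadratic_def by argo
qed

end

end

text \<open>A kernel vector \<open>x\<close> of the Gram matrix has \<open>B e\<^sub>i x = 0\<close> for all basis vectors, hence
\<open>B x x = 0\<close>.\<close>

lemma pos_def_form_gram_det:
  fixes B :: "real ^ 'n \<Rightarrow> real ^ 'n \<Rightarrow> real"
  assumes "pos_def_form B"
  shows "det (\<chi> i j. B (axis i 1) (axis j 1)) \<noteq> 0"
proof
  interpret pos_def_form B by (fact assms)
  assume "det (\<chi> i j. B (axis i 1) (axis j 1)) = 0"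
  then obtain x where x: "x \<noteq> 0" "(\<chi> i j. B (axis i 1) (axis j 1)) *v x = 0"
    by (metis invertible_det_nz invertible_left_inverse matrix_left_invertible_ker)
  have expand: "x = (\<Sum>j\<in>UNIV. x $ j *\<^sub>R axis j 1)"
    by (metis basis_expansion scalar_mult_eq_scaleR)
  have row: "B (axis i 1) x = 0" for i
  proof -
    have "B (axis i 1) x = (\<Sum>j\<in>UNIV. B (axis i 1) (axis j 1) * x $ j)"
      by (subst expand) (simp add: linear_sum[OF linear_right] scale_right mult.commute)
    also have "\<dots> = 0"
      using x(2) by (simp add: matrix_vector_mult_def vec_eq_iff)
    finally show ?thesis .
  qed
  have "B x x = (\<Sum>j\<in>UNIV. x $ j * B (axis j 1) x)"
    by (subst (1) expand) (simp add: linear_sum[OF linear_left] scale_left)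
  also have "\<dots> = 0"
    by (simp add: row)
  finally show False
    using pos[OF x(1)] by simp
qed

section \<open>Tangent spaces in charts\<close>

definition transition_deriv ::
  "('a, 'n::finite) chart \<Rightarrow> ('a, 'n) chart \<Rightarrow> 'a \<Rightarrow> real ^ 'n \<Rightarrow> real ^ 'n" where
  "transition_deriv c d p = frechet_derivative (coord d \<circ> coord_inv c) (at (coord c p))"

text \<open>The tangent vector at \<open>p\<close> with components \<open>x\<close> in the chart \<open>c\<close>. For \<open>c \<in> A\<close> around \<open>p\<close> this
is the linear isomorphism of \<open>\<real>\<^sup>n\<close> onto the tangent space whose inverse is evaluation at \<open>c\<close>;
all questions about tangent vectors are transported to \<open>\<real>\<^sup>n\<close> along it.\<close>

definition tangent_of ::
  "('a, 'n::finite) chart set \<Rightarrow> ('a, 'n) chart \<Rightarrow> 'a \<Rightarrow> real ^ 'n \<Rightarrow> ('a, 'n) tangent" where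
  "tangent_of A c p x = (\<lambda>d. if d \<in> A \<and> p \<in> dom_of d then transition_deriv c d p x else 0)"

lemma coord_vector_eq_tangent_of: "coord_vector A c i p = tangent_of A c p (axis i 1)"
  by (simp add: coord_vector_def tangent_of_def transition_deriv_def cong: if_cong)

lemma C1_map_component:
  fixes F :: "'a \<Rightarrow> real ^ 'm::finite"
  assumes "C1_map A F"
  shows "C1_map A (\<lambda>q. F q $ i)"
  unfolding C1_map_def
proof
  fix c assume "c \<in> A"
  then have diff: "\<And>x. x \<in> coord c ` dom_of c \<Longrightarrow> (F \<circ> coord_inv c) differentiable (at x)"
    and cont: "\<And>v. continuous_on (coord c ` dom_of c) (\<lambda>x. frechet_derivative (F \<circ> coord_inv c) (at x) v)"
    using assms by (auto simp: C1_map_def)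
  have D: "((\<lambda>q. F q $ i) \<circ> coord_inv c has_derivative
      (\<lambda>v. frechet_derivative (F \<circ> coord_inv c) (at x) v $ i)) (at x)"
    if "x \<in> coord c ` dom_of c" for x
    using bounded_linear.has_derivative[OF bounded_linear_vec_nth
        diff[OF that, unfolded frechet_derivative_works]]
    by (simp add: o_def)
  have "continuous_on (coord c ` dom_of c)
      (\<lambda>x. frechet_derivative ((\<lambda>q. F q $ i) \<circ> coord_inv c) (at x) v)" for v
  proof (rule continuous_on_eq)
    show "continuous_on (coord c ` dom_of c) (\<lambda>x. frechet_derivative (F \<circ> coord_inv c) (at x) v $ i)"
      using cont by (rule continuous_on_component)
    show "frechet_derivative (F \<circ> coord_inv c) (at x) v $ i
        = frechet_derivative ((\<lambda>q. F q $ i) \<circ> coord_inv c) (at x) v"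
      if "x \<in> coord c ` dom_of c" for x
      using frechet_derivative_at[OF D[OF that]] by (rule fun_cong)
  qed
  then show "Ck_on 1 (coord c ` dom_of c) ((\<lambda>q. F q $ i) \<circ> coord_inv c)"
    using D by (auto simp: differentiable_def)
qed

context smooth_manifold
begin

lemma chart_subset: "c \<in> A \<Longrightarrow> dom_of c \<subseteq> topspace M"
  using charts[of c] by (simp add: is_chart_def openin_subset)

lemma chart_open: "c \<in> A \<Longrightarrow> openin M (dom_of c)"
  using charts by (simp add: is_chart_def)

lemma chart_at:
  assumes "p \<in> topspace M"
  obtains c where "c \<in> A" "p \<in> dom_of c"
  using assms cover by blast

lemma coord_inj:
  assumes "c \<in> A"
  shows "inj_on (coord c) (dom_of c)"
proof -
  have "topspace (subtopology M (dom_of c)) = dom_of c"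
    using chart_subset[OF assms] by auto
  then show ?thesis
    using charts[OF assms] homeomorphic_imp_injective_map[of "subtopology M (dom_of c)"]
    by (auto simp: is_chart_def)
qed

lemma coord_inv_coord: "c \<in> A \<Longrightarrow> p \<in> dom_of c \<Longrightarrow> coord_inv c (coord c p) = p"
  by (simp add: coord_inv_def coord_inj)

lemma open_coord_image:
  assumes "c \<in> A" "openin M U"
  shows "open (coord c ` (dom_of c \<inter> U))"
proof -
  have h: "homeomorphic_map (subtopology M (dom_of c)) (top_of_set (coord c ` dom_of c)) (coord c)"
    and o: "open (coord c ` dom_of c)"
    using charts[OF assms(1)] by (auto simp: is_chart_def)
  have "openin (subtopology M (dom_of c)) (dom_of c \<inter> U)"
    using assms(2) by (rule openin_subtopology_Int2)
  then have "openin (top_of_set (coord c ` dom_of c)) (coord c ` (dom_of c \<inter> U))"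
    using homeomorphic_imp_open_map[OF h] by (simp add: open_map_def)
  then show ?thesis
    using o by (rule openin_open_trans)
qed

lemma open_coord_dom: "c \<in> A \<Longrightarrow> open (coord c ` dom_of c)"
  using charts by (simp add: is_chart_def)

lemma transition_has_derivative:
  assumes "c \<in> A" "d \<in> A" "p \<in> dom_of c" "p \<in> dom_of d"
  shows "(coord d \<circ> coord_inv c has_derivative transition_deriv c d p) (at (coord c p))"
proof -
  have "Ck_on 1 (coord c ` (dom_of c \<inter> dom_of d)) (coord d \<circ> coord_inv c)"
    using transition[OF assms(1,2)] unfolding smooth_on_def by blast
  then have "(coord d \<circ> coord_inv c) differentiable (at (coord c p))"
    using assms by auto
  then show ?thesis
    by (simp add: transition_deriv_def frechet_derivative_works)
qed

lemma linear_transition_deriv: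
  assumes "c \<in> A" "d \<in> A" "p \<in> dom_of c" "p \<in> dom_of d"
  shows "linear (transition_deriv c d p)"
  using transition_has_derivative[OF assms] by (rule has_derivative_linear)

text \<open>The chain rule for the change of charts. Taking for \<open>f\<close> a third coordinate map gives the cocycle
identity of the transition derivatives; taking a function on \<open>M\<close> shows that its differential
does not depend on the chart.\<close>

lemma has_derivative_change_chart:
  assumes "c \<in> A" "d \<in> A" "p \<in> dom_of c" "p \<in> dom_of d"
    and f: "(f \<circ> coord_inv d has_derivative f') (at (coord d p))"
  shows "(f \<circ> coord_inv c has_derivative f' \<circ> transition_deriv c d p) (at (coord c p))"
proof (rule has_derivative_transform_within_open)
  show "((f \<circ> coord_inv d) \<circ> (coord d \<circ> coord_inv c) has_derivative f' \<circ> transition_deriv c d p)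
      (at (coord c p))"
    using assms by (intro diff_chain_at transition_has_derivative) (simp_all add: coord_inv_coord)
  show "open (coord c ` (dom_of c \<inter> dom_of d))"
    using assms by (intro open_coord_image chart_open)
  show "((f \<circ> coord_inv d) \<circ> (coord d \<circ> coord_inv c)) x = (f \<circ> coord_inv c) x"
    if "x \<in> coord c ` (dom_of c \<inter> dom_of d)" for x
    using that assms by (auto simp: coord_inv_coord)
qed (use assms in auto)

lemma transition_deriv_self:
  assumes "c \<in> A" "p \<in> dom_of c"
  shows "transition_deriv c c p x = x"
proof -
  have "(coord c \<circ> coord_inv c has_derivative (\<lambda>x. x)) (at (coord c p))"
  proof (rule has_derivative_transform_within_open)
    show "((\<lambda>x. x) has_derivative (\<lambda>x. x)) (at (coord c p))"
      by (rule has_derivative_ident)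
    show "open (coord c ` dom_of c)"
      using assms(1) by (rule open_coord_dom)
  qed (use assms in \<open>auto simp: coord_inv_coord\<close>)
  from has_derivative_unique[OF transition_has_derivative[OF assms(1,1,2,2)] this]
  show ?thesis
    by simp
qed

lemma transition_deriv_trans:
  assumes "c \<in> A" "d \<in> A" "e \<in> A" "p \<in> dom_of c" "p \<in> dom_of d" "p \<in> dom_of e"
  shows "transition_deriv c e p x = transition_deriv d e p (transition_deriv c d p x)"
proof -
  have "(coord e \<circ> coord_inv c has_derivative transition_deriv d e p \<circ> transition_deriv c d p)
      (at (coord c p))"
    using assms by (intro has_derivative_change_chart transition_has_derivative)
  from has_derivative_unique[OF transition_has_derivative[OF assms(1,3,4,6)] this]
  show ?thesis
    by simp
qed

text \<open>The compatibility of the components is exactly the cocycle identity.\<close>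

lemma tangent_of_in_tangent_space:
  assumes "c \<in> A" "p \<in> dom_of c"
  shows "tangent_of A c p x \<in> tangent_space A p"
proof -
  have "tangent_of A c p x e = transition_deriv d e p (tangent_of A c p x d)"
    if "d \<in> A" "e \<in> A" "p \<in> dom_of d \<inter> dom_of e" for d e
    using transition_deriv_trans[of c d e p x] that assms by (simp add: tangent_of_def)
  moreover have "tangent_of A c p x d = 0" if "\<not> (d \<in> A \<and> p \<in> dom_of d)" for d
    using that by (auto simp: tangent_of_def)
  ultimately show ?thesis
    unfolding tangent_space_def transition_deriv_def[symmetric] by blast
qed

lemma tangent_of_component:
  assumes "c \<in> A" "p \<in> dom_of c"
  shows "tangent_of A c p x c = x"
  using assms by (simp add: tangent_of_def transition_deriv_self)

lemma tangent_change_chart: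
  assumes "v \<in> tangent_space A p" "c \<in> A" "d \<in> A" "p \<in> dom_of c" "p \<in> dom_of d"
  shows "v d = transition_deriv c d p (v c)"
  using assms unfolding tangent_space_def transition_deriv_def by blast

lemma tangent_of_eq:
  assumes "c \<in> A" "p \<in> dom_of c" "v \<in> tangent_space A p"
  shows "tangent_of A c p (v c) = v"
proof
  fix d
  show "tangent_of A c p (v c) d = v d"
  proof (cases "d \<in> A \<and> p \<in> dom_of d")
    case True
    then show ?thesis
      using tangent_change_chart[of v p c d] assms by (simp add: tangent_of_def)
  next
    case False
    then have "v d = 0"
      using assms(3) unfolding tangent_space_def by blast
    with False show ?thesis
      by (auto simp: tangent_of_def)
  qed
qed

lemma tangent_of_add:
  assumes "c \<in> A" "p \<in> dom_of c"
  shows "tangent_of A c p (x + y) = tangent_add (tangent_of A c p x) (tangent_of A c p y)"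
  using assms
  by (intro ext) (simp add: tangent_of_def tangent_add_def linear_add[OF linear_transition_deriv])

lemma tangent_of_scale:
  assumes "c \<in> A" "p \<in> dom_of c"
  shows "tangent_of A c p (r *\<^sub>R x) = tangent_scale r (tangent_of A c p x)"
  using assms
  by (intro ext) (simp add: tangent_of_def tangent_scale_def linear_scale[OF linear_transition_deriv])

lemma tangent_scale_in_tangent_space:
  assumes "p \<in> topspace M" "v \<in> tangent_space A p"
  shows "tangent_scale r v \<in> tangent_space A p"
proof -
  obtain c where "c \<in> A" "p \<in> dom_of c"
    using assms(1) by (rule chart_at)
  then show ?thesis
    using tangent_of_scale[of c p r "v c"] tangent_of_in_tangent_space[of c p "r *\<^sub>R v c"]
      tangent_of_eq[of c p v] assms(2) by simp
qed

lemma differential_eq: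
  assumes "C1_map A f" "c \<in> A" "p \<in> dom_of c" "v \<in> tangent_space A p"
  shows "differential A f p v = frechet_derivative (f \<circ> coord_inv c) (at (coord c p)) (v c)"
  unfolding differential_def
proof (rule the_equality)
  have D: "(f \<circ> coord_inv d has_derivative frechet_derivative (f \<circ> coord_inv d) (at (coord d p)))
      (at (coord d p))" if "d \<in> A" "p \<in> dom_of d" for d
    using assms(1) that by (auto simp: C1_map_def simp flip: frechet_derivative_works)
  show "\<forall>d\<in>A. p \<in> dom_of d \<longrightarrow>
      frechet_derivative (f \<circ> coord_inv c) (at (coord c p)) (v c) =
      frechet_derivative (f \<circ> coord_inv d) (at (coord d p)) (v d)"
  proof (intro ballI impI)
    fix d assume d: "d \<in> A" "p \<in> dom_of d"
    have "v d = transition_deriv c d p (v c)"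
      using assms d by (intro tangent_change_chart)
    moreover have "frechet_derivative (f \<circ> coord_inv d) (at (coord d p)) \<circ> transition_deriv c d p
        = frechet_derivative (f \<circ> coord_inv c) (at (coord c p))"
      using assms d by (intro frechet_derivative_at has_derivative_change_chart D)
    ultimately show "frechet_derivative (f \<circ> coord_inv c) (at (coord c p)) (v c) =
        frechet_derivative (f \<circ> coord_inv d) (at (coord d p)) (v d)"
      by (simp flip: \<open>_ = frechet_derivative (f \<circ> coord_inv c) (at (coord c p))\<close>)
  qed
qed (use assms in blast)

end

section \<open>The gradient and the steepest descent direction\<close>

context riemannian_manifold
begin

definition metric_in_chart :: "('a, 'n) chart \<Rightarrow> 'a \<Rightarrow> real ^ 'n \<Rightarrow> real ^ 'n \<Rightarrow> real" where
  "metric_in_chart c p x y = g p (tangent_of A c p x) (tangent_of A c p y)"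

lemma pos_def_form_metric:
  assumes "c \<in> A" "p \<in> dom_of c"
  shows "pos_def_form (metric_in_chart c p)"
proof
  have p: "p \<in> topspace M"
    using assms chart_subset by blast
  note T = tangent_of_in_tangent_space[OF assms]
  have sym: "metric_in_chart c p x y = metric_in_chart c p y x" for x y
    by (simp add: metric_in_chart_def metric_sym[OF p T T])
  have left: "linear (\<lambda>x. metric_in_chart c p x y)" for y
    using assms by (intro linearI)
      (simp_all add: metric_in_chart_def tangent_of_add tangent_of_scale metric_add[OF p T T T]
        metric_scale[OF p T T])
  have flip: "(\<lambda>y. metric_in_chart c p y x) = metric_in_chart c p x" for x
    by (rule ext) (rule sym)
  have "linear (metric_in_chart c p x)" for x
    using left[of x] unfolding flip .
  with left show "bilinear (metric_in_chart c p)"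
    by (simp add: bilinear_def)
  show "0 < metric_in_chart c p x x" if "x \<noteq> 0" for x
  proof -
    have "tangent_of A c p x \<noteq> tangent_zero"
      using tangent_of_component[OF assms, of x] that by (auto simp: tangent_zero_def)
    then show ?thesis
      unfolding metric_in_chart_def by (rule metric_pos[OF p T])
  qed
qed

lemma metric_eq_in_chart:
  assumes "c \<in> A" "p \<in> dom_of c" "v \<in> tangent_space A p" "w \<in> tangent_space A p"
  shows "g p v w = metric_in_chart c p (v c) (w c)"
  using assms by (simp add: metric_in_chart_def tangent_of_eq)

text \<open>The gradient is defined by a definite description, so nothing can be said about it before
existence and uniqueness of the representing vector are known; both come from \<open>riesz\<close> in a
chart.\<close>

lemma riem_grad:
  assumes f: "C1_map A f" and p: "p \<in> topspace M"
  shows riem_grad_in_tangent_space: "riem_grad A g f p \<in> tangent_space A p"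
    and riem_grad_represents:
      "\<And>v. v \<in> tangent_space A p \<Longrightarrow> g p (riem_grad A g f p) v = differential A f p v"
proof -
  obtain c where c: "c \<in> A" "p \<in> dom_of c"
    using p by (rule chart_at)
  interpret pos_def_form "metric_in_chart c p"
    using c by (rule pos_def_form_metric)
  have "(f \<circ> coord_inv c) differentiable (at (coord c p))"
    using f c by (auto simp: C1_map_def)
  then have "linear (frechet_derivative (f \<circ> coord_inv c) (at (coord c p)))"
    by (rule linear_frechet_derivative)
  from riesz[OF this] obtain a where a:
    "\<And>x. metric_in_chart c p a x = frechet_derivative (f \<circ> coord_inv c) (at (coord c p)) x"
    and unique: "\<And>b. \<forall>x. metric_in_chart c p b x
      = frechet_derivative (f \<circ> coord_inv c) (at (coord c p)) x \<Longrightarrow> b = a"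
    by blast
  have "riem_grad A g f p = tangent_of A c p a"
    unfolding riem_grad_def
  proof (rule the_equality)
    show "tangent_of A c p a \<in> tangent_space A p \<and>
        (\<forall>v\<in>tangent_space A p. g p (tangent_of A c p a) v = differential A f p v)"
      using c f by (simp add: tangent_of_in_tangent_space metric_eq_in_chart differential_eq
          tangent_of_component a)
    fix w assume w: "w \<in> tangent_space A p \<and> (\<forall>v\<in>tangent_space A p. g p w v = differential A f p v)"
    have "w c = a"
    proof (rule unique, rule allI)
      fix x
      have "g p w (tangent_of A c p x) = differential A f p (tangent_of A c p x)"
        using w c by (simp add: tangent_of_in_tangent_space)
      then show "metric_in_chart c p (w c) x = frechet_derivative (f \<circ> coord_inv c) (at (coord c p)) x"
        using w c f by (simp add: tangent_of_in_tangent_space metric_eq_in_chart differential_eq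
            tangent_of_component)
    qed
    then show "w = tangent_of A c p a"
      using w tangent_of_eq[OF c, of w] by simp
  qed
  then show "riem_grad A g f p \<in> tangent_space A p"
    and "\<And>v. v \<in> tangent_space A p \<Longrightarrow> g p (riem_grad A g f p) v = differential A f p v"
    using c f by (simp_all add: tangent_of_in_tangent_space metric_eq_in_chart differential_eq
        tangent_of_component a)
qed

text \<open>In a chart around \<open>p\<close> the objective becomes \<open>max_plus_quadratic\<close> for the linear functions
\<open>x \<mapsto> \<langle>grad f\<^sub>i(p), x\<rangle>\<close>, and a direction that witnesses the failure of Pareto
criticality is one on which all of them are negative.\<close>

lemma descent_direction:
  fixes F :: "'a \<Rightarrow> real ^ 'm::finite"
  assumes F: "C1_map A F" and p: "p \<in> topspace M"
  shows descent_direction_ex1: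
      "\<exists>!v. is_arg_min (descent_objective A g F p) (\<lambda>v. v \<in> tangent_space A p) v"
    and descent_direction_negative:
      "is_arg_min (descent_objective A g F p) (\<lambda>v. v \<in> tangent_space A p) v \<Longrightarrow>
       \<not> pareto_critical A g F p \<Longrightarrow> grad_apply A g F p v $ i < 0"
proof -
  obtain c where c: "c \<in> A" "p \<in> dom_of c"
    using p by (rule chart_at)
  interpret pos_def_form "metric_in_chart c p"
    using c by (rule pos_def_form_metric)
  let ?T = "tangent_of A c p"
  define l where "l i x = g p (riem_grad A g (\<lambda>q. F q $ i) p) (?T x)" for i x
  note grad = riem_grad_in_tangent_space[OF C1_map_component[OF F] p]
  have "l i = metric_in_chart c p (riem_grad A g (\<lambda>q. F q $ i) p c)" for i
    using c by (auto simp: l_def metric_eq_in_chart grad tangent_of_in_tangent_space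
        tangent_of_component)
  then have l: "linear (l i)" for i
    by (simp add: linear_right)
  have obj: "descent_objective A g F p (?T x) = max_plus_quadratic l x" for x
    using nonneg[of x] max_plus_quadratic_def[of l]
    by (simp add: descent_objective_def l_def riem_norm_def metric_in_chart_def)
  have obj': "descent_objective A g F p v = max_plus_quadratic l (v c)"
    if "v \<in> tangent_space A p" for v
    using obj[of "v c"] that c by (simp add: tangent_of_eq)
  have arg_min: "is_arg_min (descent_objective A g F p) (\<lambda>v. v \<in> tangent_space A p) v
      \<longleftrightarrow> v \<in> tangent_space A p \<and> is_arg_min (max_plus_quadratic l) (\<lambda>_. True) (v c)" for v
  proof -
    have "(\<forall>w\<in>tangent_space A p. descent_objective A g F p v \<le> descent_objective A g F p w)
        \<longleftrightarrow> (\<forall>x. max_plus_quadratic l (v c) \<le> max_plus_quadratic l x)"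
      if v: "v \<in> tangent_space A p"
    proof
      assume min: "\<forall>w\<in>tangent_space A p. descent_objective A g F p v \<le> descent_objective A g F p w"
      show "\<forall>x. max_plus_quadratic l (v c) \<le> max_plus_quadratic l x"
        using bspec[OF min tangent_of_in_tangent_space[OF c]] by (simp add: obj obj' v)
    qed (simp add: obj' v)
    then show ?thesis
      by (auto simp: is_arg_min_linorder)
  qed
  obtain x where x: "is_arg_min (max_plus_quadratic l) (\<lambda>_. True) x"
    and unique: "\<forall>y. is_arg_min (max_plus_quadratic l) (\<lambda>_. True) y \<longrightarrow> y = x"
    using max_plus_quadratic_ex1_arg_min[where l = l, OF l] unfolding Ex1_def by (elim exE conjE)
  show "\<exists>!v. is_arg_min (descent_objective A g F p) (\<lambda>v. v \<in> tangent_space A p) v"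
  proof (rule ex1I)
    show "is_arg_min (descent_objective A g F p) (\<lambda>v. v \<in> tangent_space A p) (?T x)"
      using c x by (simp add: arg_min tangent_of_in_tangent_space tangent_of_component)
    show "v = ?T x" if "is_arg_min (descent_objective A g F p) (\<lambda>v. v \<in> tangent_space A p) v" for v
    proof -
      have v: "v \<in> tangent_space A p" and "v c = x"
        using that unique by (auto simp: arg_min)
      then show ?thesis
        using tangent_of_eq[OF c v] by simp
    qed
  qed
  assume v: "is_arg_min (descent_objective A g F p) (\<lambda>v. v \<in> tangent_space A p) v"
    and "\<not> pareto_critical A g F p"
  then obtain w y where w: "w \<in> tangent_space A p" "grad_apply A g F p w = - y" "\<And>i. 0 < y $ i"
    unfolding pareto_critical_def by blast
  have grad_l: "grad_apply A g F p u $ i = l i (u c)" if "u \<in> tangent_space A p" for u i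
    using that c by (simp add: grad_apply_def l_def tangent_of_eq)
  have neg: "l j (w c) < 0" for j
    using w(3)[of j] grad_l[OF w(1), of j] w(2) by simp
  have min: "is_arg_min (max_plus_quadratic l) (\<lambda>_. True) (v c)"
    using v by (simp add: arg_min)
  have "l i (v c) < 0"
    by (rule arg_min_descends[where l = l and w = "w c", OF l min neg])
  then show "grad_apply A g F p v $ i < 0"
    using v by (simp add: arg_min grad_l)
qed

end

section \<open>Geodesics and the exponential map\<close>

text \<open>Pairing position and velocity turns the geodesic equation, which is of second order, into a
first-order autonomous equation with right-hand side \<open>geodesic_field\<close>.\<close>

definition phase_curve ::
  "('a, 'n::finite) chart \<Rightarrow> (real \<Rightarrow> 'a) \<Rightarrow> real \<Rightarrow> (real ^ 'n) \<times> (real ^ 'n)" where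
  "phase_curve c \<gamma> t = (coord c (\<gamma> t), vector_derivative (coord c \<circ> \<gamma>) (at t))"

definition geodesic_field ::
  "('a, 'n::finite) chart set \<Rightarrow> ('a, 'n) metric \<Rightarrow> ('a, 'n) chart \<Rightarrow>
   (real ^ 'n) \<times> (real ^ 'n) \<Rightarrow> (real ^ 'n) \<times> (real ^ 'n)" where
  "geodesic_field A g c z = (snd z,
     (\<chi> k. - (\<Sum>i\<in>UNIV. \<Sum>j\<in>UNIV. christoffel A g c k i j (fst z) * snd z $ i * snd z $ j)))"

lemma velocity_cong:
  fixes A :: "('a, 'n::finite) chart set"
  assumes "\<forall>\<^sub>F s in nhds t. \<gamma> s = \<gamma>' s"
  shows "velocity A \<gamma> t = velocity A \<gamma>' t"
proof -
  have "\<gamma> t = \<gamma>' t"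
    using assms by (rule eventually_nhds_x_imp_x)
  moreover have "vector_derivative (coord c \<circ> \<gamma>) (at t) = vector_derivative (coord c \<circ> \<gamma>') (at t)"
    for c :: "('a, 'n) chart"
    using assms by (intro vector_derivative_cong_eq) (auto elim: eventually_mono)
  ultimately show ?thesis
    by (simp add: velocity_def cong: if_cong)
qed

lemma velocity_component:
  "c \<in> A \<Longrightarrow> \<gamma> t \<in> dom_of c \<Longrightarrow> velocity A \<gamma> t c = vector_derivative (coord c \<circ> \<gamma>) (at t)"
  by (simp add: velocity_def)

lemma velocity_reparametrize_linear:
  assumes "\<And>c. c \<in> A \<Longrightarrow> \<gamma> (a * t) \<in> dom_of c \<Longrightarrow> (coord c \<circ> \<gamma>) differentiable (at (a * t))"
  shows "velocity A (\<lambda>s. \<gamma> (a * s)) t = tangent_scale a (velocity A \<gamma> (a * t))"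
proof
  fix c
  show "velocity A (\<lambda>s. \<gamma> (a * s)) t c = tangent_scale a (velocity A \<gamma> (a * t)) c"
  proof (cases "c \<in> A \<and> \<gamma> (a * t) \<in> dom_of c")
    case True
    then have "(coord c \<circ> \<gamma> has_vector_derivative vector_derivative (coord c \<circ> \<gamma>) (at (a * t)))
        (at (a * t))"
      using assms by (simp add: vector_derivative_works)
    moreover have "((*) a has_vector_derivative a) (at t)"
      by (auto intro!: derivative_eq_intros)
    ultimately have "((coord c \<circ> \<gamma>) \<circ> (*) a has_vector_derivative
        a *\<^sub>R vector_derivative (coord c \<circ> \<gamma>) (at (a * t))) (at t)"
      by (intro vector_diff_chain_at)
    then have "vector_derivative (coord c \<circ> (\<lambda>s. \<gamma> (a * s))) (at t)
        = a *\<^sub>R vector_derivative (coord c \<circ> \<gamma>) (at (a * t))"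
      by (intro vector_derivative_at) (simp add: o_def)
    with True show ?thesis
      by (simp add: velocity_def tangent_scale_def)
  qed (auto simp: velocity_def tangent_scale_def)
qed

lemma geodesic_continuous: "geodesic M A g \<gamma> \<Longrightarrow> continuous_map euclideanreal M \<gamma>"
  by (simp add: geodesic_def)

lemma geodesic_in_topspace: "geodesic M A g \<gamma> \<Longrightarrow> \<gamma> t \<in> topspace M"
  using continuous_map_image_subset_topspace[OF geodesic_continuous, of M A g \<gamma>] by auto

lemma geodesic_stays_in_open:
  assumes "geodesic M A g \<gamma>" "openin M U" "\<gamma> t \<in> U"
  shows "\<forall>\<^sub>F s in nhds t. \<gamma> s \<in> U"
proof -
  have "openin euclideanreal {s \<in> topspace euclideanreal. \<gamma> s \<in> U}"
    using geodesic_continuous[OF assms(1)] assms(2) by (rule openin_continuous_map_preimage)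
  then have "open {s. \<gamma> s \<in> U}"
    by simp
  then show ?thesis
    using assms(3) eventually_nhds_in_open[of "{s. \<gamma> s \<in> U}" t] by simp
qed

lemma geodesic_coord_differentiable:
  assumes "geodesic M A g \<gamma>" "c \<in> A" "\<gamma> t \<in> dom_of c"
  shows "(coord c \<circ> \<gamma>) differentiable (at t)"
  using assms unfolding geodesic_def Let_def by blast

lemma phase_curve_has_derivative:
  assumes "geodesic M A g \<gamma>" "c \<in> A" "\<gamma> t \<in> dom_of c"
  shows "(phase_curve c \<gamma> has_vector_derivative geodesic_field A g c (phase_curve c \<gamma> t)) (at t)"
proof -
  have "((coord c \<circ> \<gamma>) has_vector_derivative vector_derivative (coord c \<circ> \<gamma>) (at t)) (at t)"
    using geodesic_coord_differentiable[OF assms] by (simp add: vector_derivative_works)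
  moreover have "((\<lambda>s. vector_derivative (coord c \<circ> \<gamma>) (at s)) has_vector_derivative
      snd (geodesic_field A g c (phase_curve c \<gamma> t))) (at t)"
    using assms by (auto simp: geodesic_def Let_def geodesic_field_def phase_curve_def)
  ultimately have "((\<lambda>s. ((coord c \<circ> \<gamma>) s, vector_derivative (coord c \<circ> \<gamma>) (at s))) has_vector_derivative
      (vector_derivative (coord c \<circ> \<gamma>) (at t), snd (geodesic_field A g c (phase_curve c \<gamma> t)))) (at t)"
    by (rule has_vector_derivative_Pair)
  then show ?thesis
    by (simp add: phase_curve_def[abs_def] geodesic_field_def)
qed

text \<open>With its converse \<open>phase_curve_has_derivative\<close>, this lets the proofs below treat geodesics as
solutions of the first-order equation.\<close>

lemma geodesicI_phase:
  assumes "continuous_map euclideanreal M \<gamma>"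
    and "\<And>c t. c \<in> A \<Longrightarrow> \<gamma> t \<in> dom_of c \<Longrightarrow>
      (phase_curve c \<gamma> has_vector_derivative geodesic_field A g c (phase_curve c \<gamma> t)) (at t)"
  shows "geodesic M A g \<gamma>"
  unfolding geodesic_def Let_def
proof (intro conjI ballI allI impI)
  fix c t assume c: "c \<in> A" "\<gamma> t \<in> dom_of c"
  note D = assms(2)[OF c]
  have "(fst \<circ> phase_curve c \<gamma> has_vector_derivative fst (geodesic_field A g c (phase_curve c \<gamma> t))) (at t)"
    using bounded_linear.has_vector_derivative[OF bounded_linear_fst D] by (simp add: o_def)
  then show "coord c \<circ> \<gamma> differentiable (at t)"
    by (auto simp: phase_curve_def o_def intro: differentiableI_vector)
  show "((\<lambda>s. vector_derivative (coord c \<circ> \<gamma>) (at s)) has_vector_derivative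
      (\<chi> k. - (\<Sum>i\<in>UNIV. \<Sum>j\<in>UNIV. christoffel A g c k i j ((coord c \<circ> \<gamma>) t)
        * vector_derivative (coord c \<circ> \<gamma>) (at t) $ i * vector_derivative (coord c \<circ> \<gamma>) (at t) $ j)))
      (at t)"
    using bounded_linear.has_vector_derivative[OF bounded_linear_snd D]
    by (simp add: phase_curve_def geodesic_field_def)
qed (fact assms(1))

text \<open>Rescaling the time by \<open>a\<close> multiplies the velocity by \<open>a\<close> and the acceleration by \<open>a\<^sup>2\<close>,
which matches the right-hand side of the geodesic equation because that is quadratic in the
velocity.\<close>

lemma geodesic_reparametrize_linear:
  fixes A :: "('a, 'n::finite) chart set"
  assumes "geodesic M A g \<gamma>" and A: "\<And>c. c \<in> A \<Longrightarrow> openin M (dom_of c)"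
  shows "geodesic M A g (\<lambda>t. \<gamma> (a * t))"
proof (rule geodesicI_phase)
  have "continuous_map euclideanreal euclideanreal ((*) a)"
    by (simp add: continuous_on_mult_left)
  from continuous_map_compose[OF this geodesic_continuous[OF assms(1)]]
  show "continuous_map euclideanreal M (\<lambda>t. \<gamma> (a * t))"
    by (simp add: o_def)
next
  fix c t assume c: "c \<in> A" "\<gamma> (a * t) \<in> dom_of c"
  let ?S = "\<lambda>z::(real ^ 'n) \<times> (real ^ 'n). (fst z, a *\<^sub>R snd z)"
  have lin: "bounded_linear ?S"
    by (intro bounded_linear_intros)
  have phase: "phase_curve c (\<lambda>t. \<gamma> (a * t)) s = ?S (phase_curve c \<gamma> (a * s))"
    if "\<gamma> (a * s) \<in> dom_of c" for s
    using velocity_reparametrize_linear[of A \<gamma> a s]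
      geodesic_coord_differentiable[OF assms(1), of _ "a * s"] c(1) that
      velocity_component[of c A "\<lambda>t. \<gamma> (a * t)" s] velocity_component[of c A \<gamma> "a * s"]
    by (simp add: phase_curve_def tangent_scale_def)
  have "((*) a has_vector_derivative a) (at t)"
    by (auto intro!: derivative_eq_intros)
  then have "(phase_curve c \<gamma> \<circ> (*) a has_vector_derivative
      a *\<^sub>R geodesic_field A g c (phase_curve c \<gamma> (a * t))) (at t)"
    using phase_curve_has_derivative[OF assms(1) c] by (rule vector_diff_chain_at)
  then have D: "((\<lambda>s. ?S (phase_curve c \<gamma> (a * s))) has_vector_derivative
      ?S (a *\<^sub>R geodesic_field A g c (phase_curve c \<gamma> (a * t)))) (at t)"
    unfolding o_def by (rule bounded_linear.has_vector_derivative[OF lin])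
  have field: "?S (a *\<^sub>R geodesic_field A g c (phase_curve c \<gamma> (a * t)))
      = geodesic_field A g c (?S (phase_curve c \<gamma> (a * t)))"
    by (simp add: geodesic_field_def vec_eq_iff sum_distrib_left mult_ac)
  have "\<forall>\<^sub>F s in nhds t. \<gamma> (a * s) \<in> dom_of c"
  proof -
    have "((\<lambda>s. a * s) \<longlongrightarrow> a * t) (nhds t)"
      by (intro tendsto_intros filterlim_ident)
    then show ?thesis
      using geodesic_stays_in_open[OF assms(1) A[OF c(1)] c(2)] by (auto simp: filterlim_iff)
  qed
  then have near: "\<forall>\<^sub>F s in nhds t. ?S (phase_curve c \<gamma> (a * s)) = phase_curve c (\<lambda>t. \<gamma> (a * t)) s"
    by eventually_elim (simp add: phase)
  have "((\<lambda>s. ?S (phase_curve c \<gamma> (a * s))) has_vector_derivative d) (at t)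
      \<longleftrightarrow> (phase_curve c (\<lambda>t. \<gamma> (a * t)) has_vector_derivative d) (at t)" for d
    using near phase[OF c(2)] by (intro has_vector_derivative_cong_ev) simp_all
  then show "(phase_curve c (\<lambda>t. \<gamma> (a * t)) has_vector_derivative
      geodesic_field A g c (phase_curve c (\<lambda>t. \<gamma> (a * t)) t)) (at t)"
    using D by (simp only: field phase[OF c(2)])
qed

lemma (in smooth_manifold) C1_along_geodesic:
  assumes "geodesic M A g \<gamma>" "velocity A \<gamma> t \<in> tangent_space A (\<gamma> t)" "C1_map A f"
  shows "((\<lambda>s. f (\<gamma> s)) has_real_derivative differential A f (\<gamma> t) (velocity A \<gamma> t)) (at t)"
proof -
  obtain c where c: "c \<in> A" "\<gamma> t \<in> dom_of c"
    using geodesic_in_topspace[OF assms(1)] by (rule chart_at)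
  have "(f \<circ> coord_inv c) differentiable (at (coord c (\<gamma> t)))"
    using assms(3) c by (auto simp: C1_map_def)
  then have "(f \<circ> coord_inv c has_derivative frechet_derivative (f \<circ> coord_inv c) (at (coord c (\<gamma> t))))
      (at (coord c (\<gamma> t)))"
    by (rule frechet_derivative_works[THEN iffD1])
  then have "(f \<circ> coord_inv c has_derivative frechet_derivative (f \<circ> coord_inv c) (at (coord c (\<gamma> t))))
      (at ((coord c \<circ> \<gamma>) t) within range (coord c \<circ> \<gamma>))"
    unfolding comp_apply by (rule has_derivative_at_withinI)
  moreover have "(coord c \<circ> \<gamma> has_vector_derivative velocity A \<gamma> t c) (at t)"
    using geodesic_coord_differentiable[OF assms(1) c] c
    by (simp add: velocity_component vector_derivative_works)
  ultimately have "((f \<circ> coord_inv c) \<circ> (coord c \<circ> \<gamma>) has_vector_derivative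
      frechet_derivative (f \<circ> coord_inv c) (at (coord c (\<gamma> t))) (velocity A \<gamma> t c)) (at t)"
    by (intro vector_derivative_diff_chain_within)
  also have "frechet_derivative (f \<circ> coord_inv c) (at (coord c (\<gamma> t))) (velocity A \<gamma> t c)
      = differential A f (\<gamma> t) (velocity A \<gamma> t)"
    using differential_eq[OF assms(3) c assms(2)] by simp
  also have "((f \<circ> coord_inv c) \<circ> (coord c \<circ> \<gamma>) has_vector_derivative
        differential A f (\<gamma> t) (velocity A \<gamma> t)) (at t)
      \<longleftrightarrow> ((\<lambda>s. f (\<gamma> s)) has_vector_derivative differential A f (\<gamma> t) (velocity A \<gamma> t)) (at t)"
    using geodesic_stays_in_open[OF assms(1) chart_open[OF c(1)] c(2)] c
    by (intro has_vector_derivative_cong_ev) (auto elim!: eventually_mono simp: coord_inv_coord)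
  finally show ?thesis
    by (simp add: has_real_derivative_iff_has_vector_derivative)
qed

context riemannian_manifold
begin

text \<open>The inverse of the metric matrix is harmless because, as the Gram matrix of a positive definite
form, the metric matrix has nonzero determinant.\<close>

lemma lipschitz_near_christoffel:
  assumes c: "c \<in> A" and x: "x \<in> coord c ` dom_of c"
  shows "lipschitz_near (christoffel A g c k i j) x"
proof -
  let ?S = "coord c ` dom_of c"
  have smooth: "Ck_on n ?S (metric_coeff A g c i j)" for n i j
    using metric_smooth[OF c] unfolding smooth_on_def by blast
  have coeff: "lipschitz_near (metric_coeff A g c i j) x" for i j
    using smooth open_coord_dom[OF c] x by (rule Ck_on_1_lipschitz_near)
  have "Ck_on 1 ?S (partial_deriv l (metric_coeff A g c i j))" for l i j
    using smooth[of "Suc 1" i j] unfolding partial_deriv_def Ck_on.simps(2)[of 1] by blast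
  then have partial: "lipschitz_near (partial_deriv l (metric_coeff A g c i j)) x" for l i j
    using open_coord_dom[OF c] x by (rule Ck_on_1_lipschitz_near)
  obtain p where p: "p \<in> dom_of c" "x = coord c p"
    using x by blast
  have "metric_coeff A g c a b x = metric_in_chart c p (axis a 1) (axis b 1)" for a b
    using c p by (simp add: metric_coeff_def metric_in_chart_def coord_vector_eq_tangent_of
        coord_inv_coord)
  then have "det (\<chi> a b. metric_coeff A g c a b x) \<noteq> 0"
    using pos_def_form_gram_det[OF pos_def_form_metric[OF c p(1)]] by simp
  then have inv: "lipschitz_near (\<lambda>y. matrix_inv (\<chi> a b. metric_coeff A g c a b y) $ k $ l) x" for l
    using coeff by (intro lipschitz_near_matrix_inv)
  have minus: "lipschitz_near (\<lambda>y. - partial_deriv l (metric_coeff A g c i j) y) x" for l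
    using lipschitz_near_mult[OF lipschitz_near_const[of "-1"] partial] by simp
  show ?thesis
    unfolding christoffel_def[abs_def] diff_conv_add_uminus
    by (intro lipschitz_near_mult lipschitz_near_const lipschitz_near_sum lipschitz_near_add
        inv partial minus)
qed

lemma lipschitz_near_geodesic_field:
  assumes "c \<in> A" "fst z \<in> coord c ` dom_of c"
  shows "lipschitz_near (geodesic_field A g c) z"
proof -
  have fst: "lipschitz_near fst z" and snd: "lipschitz_near snd z"
    by (intro lipschitz_near_bounded_linear bounded_linear_fst bounded_linear_snd)+
  have nth: "lipschitz_near (\<lambda>z. snd z $ i) z" for i
    by (intro lipschitz_near_bounded_linear bounded_linear_compose[OF bounded_linear_vec_nth]
        bounded_linear_snd)
  have "lipschitz_near (\<lambda>z. christoffel A g c k i j (fst z)) z" for k i j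
    using fst lipschitz_near_christoffel[OF assms] by (rule lipschitz_near_compose)
  then have "lipschitz_near (\<lambda>z. (- 1) *
      (\<Sum>i\<in>UNIV. \<Sum>j\<in>UNIV. christoffel A g c k i j (fst z) * snd z $ i * snd z $ j)) z" for k
    by (intro lipschitz_near_mult lipschitz_near_const lipschitz_near_sum nth)
  then have "lipschitz_near (\<lambda>z. - (\<Sum>i\<in>UNIV. \<Sum>j\<in>UNIV.
      christoffel A g c k i j (fst z) * snd z $ i * snd z $ j)) z" for k
    by simp
  then show ?thesis
    unfolding geodesic_field_def[abs_def]
    by (intro lipschitz_near_Pair lipschitz_near_vec snd)
qed

lemma geodesics_agree_locally:
  assumes \<gamma>: "geodesic M A g \<gamma>" and \<gamma>': "geodesic M A g \<gamma>'"
    and eq: "\<gamma> t = \<gamma>' t" "velocity A \<gamma> t = velocity A \<gamma>' t"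
  shows "\<forall>\<^sub>F s in nhds t. \<gamma> s = \<gamma>' s"
proof -
  obtain c where c: "c \<in> A" "\<gamma> t \<in> dom_of c"
    using geodesic_in_topspace[OF \<gamma>] by (rule chart_at)
  have c': "\<gamma>' t \<in> dom_of c"
    using c(2) eq(1) by simp
  have near: "\<forall>\<^sub>F s in nhds t. \<gamma> s \<in> dom_of c" "\<forall>\<^sub>F s in nhds t. \<gamma>' s \<in> dom_of c"
    using geodesic_stays_in_open[OF \<gamma> chart_open[OF c(1)] c(2)]
      geodesic_stays_in_open[OF \<gamma>' chart_open[OF c(1)] c'] by auto
  have "\<forall>\<^sub>F s in nhds t. phase_curve c \<gamma> s = phase_curve c \<gamma>' s"
  proof (rule ode_local_uniqueness)
    show "lipschitz_near (geodesic_field A g c) (phase_curve c \<gamma> t)"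
      using c by (intro lipschitz_near_geodesic_field) (auto simp: phase_curve_def)
    show "\<forall>\<^sub>F s in nhds t. (phase_curve c \<gamma> has_vector_derivative
        geodesic_field A g c (phase_curve c \<gamma> s)) (at s)"
      using near(1) by eventually_elim (rule phase_curve_has_derivative[OF \<gamma> c(1)])
    show "\<forall>\<^sub>F s in nhds t. (phase_curve c \<gamma>' has_vector_derivative
        geodesic_field A g c (phase_curve c \<gamma>' s)) (at s)"
      using near(2) by eventually_elim (rule phase_curve_has_derivative[OF \<gamma>' c(1)])
    show "phase_curve c \<gamma> t = phase_curve c \<gamma>' t"
      using eq c c' velocity_component[of c A \<gamma> t] velocity_component[of c A \<gamma>' t]
      by (simp add: phase_curve_def)
  qed
  with near show ?thesis
  proof eventually_elim
    case (elim s)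
    then have "coord c (\<gamma> s) = coord c (\<gamma>' s)"
      by (simp add: phase_curve_def)
    with elim show ?case
      using coord_inj[OF c(1)] by (auto dest: inj_onD)
  qed
qed

text \<open>If the positions differ, disjoint neighbourhoods keep them apart for nearby times. If only the
velocities differ, they differ in some chart, where they depend continuously on time because a
geodesic is twice differentiable.\<close>

lemma geodesics_separate_locally:
  assumes \<gamma>: "geodesic M A g \<gamma>" and \<gamma>': "geodesic M A g \<gamma>'"
    and neq: "\<not> (\<gamma> t = \<gamma>' t \<and> velocity A \<gamma> t = velocity A \<gamma>' t)"
  shows "\<forall>\<^sub>F s in nhds t. \<not> (\<gamma> s = \<gamma>' s \<and> velocity A \<gamma> s = velocity A \<gamma>' s)"
proof (cases "\<gamma> t = \<gamma>' t")
  case False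
  then obtain U V where UV: "openin M U" "openin M V" "\<gamma> t \<in> U" "\<gamma>' t \<in> V" "disjnt U V"
    using Hausdorff[unfolded Hausdorff_space_def, rule_format, of "\<gamma> t" "\<gamma>' t"]
      geodesic_in_topspace[OF \<gamma>, of t] geodesic_in_topspace[OF \<gamma>', of t] by auto
  from geodesic_stays_in_open[OF \<gamma> UV(1,3)] geodesic_stays_in_open[OF \<gamma>' UV(2,4)]
  show ?thesis
  proof eventually_elim
    case (elim s)
    then have "\<gamma> s \<noteq> \<gamma>' s"
      using UV(5) unfolding disjnt_iff by metis
    then show ?case
      by simp
  qed
next
  case True
  with neq obtain c where c: "velocity A \<gamma> t c \<noteq> velocity A \<gamma>' t c"
    by blast
  then have dom: "c \<in> A" "\<gamma> t \<in> dom_of c" "\<gamma>' t \<in> dom_of c"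
    using True by (auto simp: velocity_def split: if_splits)
  have "isCont (phase_curve c \<gamma>) t" "isCont (phase_curve c \<gamma>') t"
    by (rule has_vector_derivative_continuous[OF phase_curve_has_derivative[OF \<gamma> dom(1,2)]],
        rule has_vector_derivative_continuous[OF phase_curve_has_derivative[OF \<gamma>' dom(1,3)]])
  then have "((\<lambda>s. phase_curve c \<gamma> s - phase_curve c \<gamma>' s) \<longlongrightarrow> phase_curve c \<gamma> t - phase_curve c \<gamma>' t) (nhds t)"
    by (intro tendsto_diff) (simp_all only: isCont_def tendsto_at_iff_tendsto_nhds)
  moreover have "phase_curve c \<gamma> t - phase_curve c \<gamma>' t \<noteq> 0"
    using c dom velocity_component[of c A \<gamma> t] velocity_component[of c A \<gamma>' t]
    by (simp add: phase_curve_def zero_prod_def)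
  ultimately have "\<forall>\<^sub>F s in nhds t. phase_curve c \<gamma> s - phase_curve c \<gamma>' s \<noteq> 0"
    by (rule tendsto_imp_eventually_ne)
  with geodesic_stays_in_open[OF \<gamma> chart_open[OF dom(1)] dom(2)]
    geodesic_stays_in_open[OF \<gamma>' chart_open[OF dom(1)] dom(3)]
  show ?thesis
  proof eventually_elim
    case (elim s)
    then show ?case
      using dom(1) velocity_component[of c A \<gamma> s] velocity_component[of c A \<gamma>' s]
      by (auto simp: phase_curve_def zero_prod_def)
  qed
qed

text \<open>The set of times at which positions and velocities agree is open, closed and nonempty in
\<open>\<real>\<close>.\<close>

theorem geodesic_unique:
  assumes \<gamma>: "geodesic M A g \<gamma>" and \<gamma>': "geodesic M A g \<gamma>'"
    and init: "\<gamma> t0 = \<gamma>' t0" "velocity A \<gamma> t0 = velocity A \<gamma>' t0"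
  shows "\<gamma> = \<gamma>'"
proof -
  define agree where "agree t \<longleftrightarrow> \<gamma> t = \<gamma>' t \<and> velocity A \<gamma> t = velocity A \<gamma>' t" for t
  have open_Collect: "open {t. P t}" if "\<And>t. P t \<Longrightarrow> \<forall>\<^sub>F s in nhds t. P s" for P :: "real \<Rightarrow> bool"
  proof (rule open_subopen[THEN iffD2], rule ballI)
    fix t assume "t \<in> {t. P t}"
    then have "\<forall>\<^sub>F s in nhds t. P s"
      by (simp add: that)
    then obtain S where "open S" "t \<in> S" "\<forall>s\<in>S. P s"
      by (auto simp: eventually_nhds)
    then show "\<exists>S. open S \<and> t \<in> S \<and> S \<subseteq> {t. P t}"
      by (intro exI[of _ S]) auto
  qed
  have "open {t. agree t}"
  proof (rule open_Collect)
    fix t assume "agree t"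
    then have "\<forall>\<^sub>F s in nhds t. \<gamma> s = \<gamma>' s"
      using geodesics_agree_locally[OF \<gamma> \<gamma>'] by (simp add: agree_def)
    then have "\<forall>\<^sub>F s in nhds t. \<forall>\<^sub>F r in nhds s. \<gamma> r = \<gamma>' r"
      by (simp add: eventually_eventually)
    then show "\<forall>\<^sub>F s in nhds t. agree s"
      by eventually_elim
        (auto simp: agree_def intro: velocity_cong dest: eventually_nhds_x_imp_x)
  qed
  moreover have "open {t. \<not> agree t}"
    using geodesics_separate_locally[OF \<gamma> \<gamma>'] by (intro open_Collect) (simp add: agree_def)
  then have "closed {t. agree t}"
    by (simp add: closed_def Compl_eq)
  moreover have "t0 \<in> {t. agree t}"
    using init by (simp add: agree_def)
  ultimately have "{t. agree t} = UNIV"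
    using clopen[of "{t. agree t}"] by auto
  then show ?thesis
    by (auto simp: agree_def)
qed

text \<open>By uniqueness, the geodesic with initial velocity \<open>a v\<close> is the rescaled geodesic
\<open>t \<mapsto> \<gamma>(a t)\<close>, which is at \<open>\<gamma>(a)\<close> at time \<open>1\<close>.\<close>

lemma riem_exp_eq:
  assumes "geodesic M A g \<gamma>"
  shows "riem_exp M A g (\<gamma> 0) (tangent_scale a (velocity A \<gamma> 0)) = \<gamma> a"
  unfolding riem_exp_def
proof (rule the_equality)
  have geo: "geodesic M A g (\<lambda>t. \<gamma> (a * t))"
    using assms chart_open by (rule geodesic_reparametrize_linear)
  have vel: "velocity A (\<lambda>t. \<gamma> (a * t)) 0 = tangent_scale a (velocity A \<gamma> 0)"
    using velocity_reparametrize_linear[of A \<gamma> a 0] geodesic_coord_differentiable[OF assms] by simp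
  show "\<exists>\<gamma>'. geodesic M A g \<gamma>' \<and> \<gamma>' 0 = \<gamma> 0 \<and>
      velocity A \<gamma>' 0 = tangent_scale a (velocity A \<gamma> 0) \<and> \<gamma>' 1 = \<gamma> a"
    using geo vel by (intro exI[of _ "\<lambda>t. \<gamma> (a * t)"]) simp
  fix q
  assume "\<exists>\<gamma>'. geodesic M A g \<gamma>' \<and> \<gamma>' 0 = \<gamma> 0 \<and>
      velocity A \<gamma>' 0 = tangent_scale a (velocity A \<gamma> 0) \<and> \<gamma>' 1 = q"
  then obtain \<gamma>' where \<gamma>': "geodesic M A g \<gamma>'" "\<gamma>' 0 = \<gamma> 0"
    "velocity A \<gamma>' 0 = tangent_scale a (velocity A \<gamma> 0)" "\<gamma>' 1 = q"
    by blast
  have "\<gamma>' = (\<lambda>t. \<gamma> (a * t))"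
    using \<gamma>'(2,3) vel by (intro geodesic_unique[OF \<gamma>'(1) geo, of 0]) simp_all
  then show "q = \<gamma> a"
    using \<gamma>'(4) by simp
qed

end

section \<open>The Armijo rule\<close>

text \<open>The difference quotients tend to \<open>D\<close>, which is smaller than \<open>\<beta> D\<close> since \<open>D\<close> is negative
and \<open>\<beta> < 1\<close>.\<close>

lemma sufficient_decrease_at_right:
  fixes h :: "real \<Rightarrow> real"
  assumes h: "(h has_real_derivative D) (at 0)" and D: "D < 0" and \<beta>: "\<beta> < 1"
  shows "\<forall>\<^sub>F t in at_right 0. h t \<le> h 0 + \<beta> * t * D"
proof -
  have "((\<lambda>t. (h t - h 0) / t) \<longlongrightarrow> D) (at_right 0)"
    using DERIV_D[OF h] by (auto intro: tendsto_mono[OF at_le])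
  moreover have "D < \<beta> * D"
    using D \<beta> by simp
  ultimately have "\<forall>\<^sub>F t in at_right 0. (h t - h 0) / t < \<beta> * D"
    by (rule order_tendstoD)
  moreover have "\<forall>\<^sub>F t in at_right 0. (0::real) < t"
    by (rule eventually_at_right_less)
  ultimately show ?thesis
    by eventually_elim (simp add: field_simps)
qed

text \<open>The largest admissible power of \<open>1/2\<close> is the one with the least exponent.\<close>

lemma armijo_steps_attain_max:
  assumes "armijo_steps M A g F \<beta> p v \<noteq> {}"
  shows "\<exists>t\<in>armijo_steps M A g F \<beta> p v. \<forall>s\<in>armijo_steps M A g F \<beta> p v. s \<le> t"
proof -
  let ?S = "armijo_steps M A g F \<beta> p v"
  obtain k where k: "(1 / 2) ^ k \<in> ?S"
    using assms by (auto simp: armijo_steps_def)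
  define j where "j = (LEAST j. (1 / 2) ^ j \<in> ?S)"
  have "(1 / 2) ^ j \<in> ?S"
    unfolding j_def using k by (rule LeastI)
  moreover have "s \<le> (1 / 2) ^ j" if s: "s \<in> ?S" for s
  proof -
    obtain i where i: "s = (1 / 2) ^ i"
      using s by (auto simp: armijo_steps_def)
    then have "j \<le> i"
      unfolding j_def using s by (intro Least_le) simp
    then show ?thesis
      unfolding i by (intro power_decreasing) auto
  qed
  ultimately show ?thesis
    by blast
qed

context riemannian_manifold
begin

lemma riem_exp_in_topspace:
  assumes "geodesically_complete M A g" "p \<in> topspace M" "v \<in> tangent_space A p"
  shows "riem_exp M A g p v \<in> topspace M"
proof -
  obtain \<gamma> where \<gamma>: "geodesic M A g \<gamma>" "\<gamma> 0 = p" "velocity A \<gamma> 0 = v"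
    using assms unfolding geodesically_complete_def by blast
  have "tangent_scale 1 v = v"
    by (simp add: tangent_scale_def)
  then have "riem_exp M A g p v = \<gamma> 1"
    using riem_exp_eq[OF \<gamma>(1), of 1] \<gamma>(2,3) by simp
  then show ?thesis
    using geodesic_in_topspace[OF \<gamma>(1)] by simp
qed

text \<open>By \<open>riem_exp_eq\<close> the trial points lie on one geodesic, along which each component of \<open>F\<close>
satisfies the inequality for all small times; there are finitely many components, and the
powers of \<open>1/2\<close> get arbitrarily small.\<close>

lemma armijo_steps_nonempty:
  fixes F :: "'a \<Rightarrow> real ^ 'm::finite"
  assumes complete: "geodesically_complete M A g" and F: "C1_map A F" and \<beta>: "\<beta> < 1"
    and p: "p \<in> topspace M" and v: "v \<in> tangent_space A p"
    and descent: "\<And>i. grad_apply A g F p v $ i < 0"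
  shows "armijo_steps M A g F \<beta> p v \<noteq> {}"
proof -
  obtain \<gamma> where \<gamma>: "geodesic M A g \<gamma>" "\<gamma> 0 = p" "velocity A \<gamma> 0 = v"
    using complete p v unfolding geodesically_complete_def by blast
  have "\<forall>\<^sub>F t in at_right 0. F (\<gamma> t) $ i \<le> F (\<gamma> 0) $ i + \<beta> * t * grad_apply A g F p v $ i" for i
  proof (rule sufficient_decrease_at_right)
    have "((\<lambda>t. F (\<gamma> t) $ i) has_real_derivative
        differential A (\<lambda>q. F q $ i) (\<gamma> 0) (velocity A \<gamma> 0)) (at 0)"
      by (rule C1_along_geodesic[OF \<gamma>(1) _ C1_map_component[OF F]]) (simp add: \<gamma> v)
    then show "((\<lambda>t. F (\<gamma> t) $ i) has_real_derivative grad_apply A g F p v $ i) (at 0)"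
      by (simp add: \<gamma> grad_apply_def riem_grad_represents[OF C1_map_component[OF F] p v])
  qed (fact descent \<beta>)+
  then have "\<forall>\<^sub>F t in at_right 0. \<forall>i. F (\<gamma> t) $ i \<le> F p $ i + \<beta> * t * grad_apply A g F p v $ i"
    unfolding \<gamma>(2) by (rule eventually_all_finite)
  moreover have "filterlim (\<lambda>j. (1 / 2) ^ j :: real) (at_right 0) sequentially"
    by (intro tendsto_imp_filterlim_at_right LIMSEQ_realpow_zero) auto
  ultimately have "\<forall>\<^sub>F j in sequentially. \<forall>i. F (\<gamma> ((1 / 2) ^ j)) $ i
      \<le> F p $ i + \<beta> * (1 / 2) ^ j * grad_apply A g F p v $ i"
    by (rule eventually_compose_filterlim)
  then obtain j where j: "\<And>i. F (\<gamma> ((1 / 2) ^ j)) $ i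
      \<le> F p $ i + \<beta> * (1 / 2) ^ j * grad_apply A g F p v $ i"
    using eventually_happens' sequentially_bot by blast
  have "riem_exp M A g p (tangent_scale ((1 / 2) ^ j) v) = \<gamma> ((1 / 2) ^ j)"
    using riem_exp_eq[OF \<gamma>(1)] by (simp add: \<gamma>)
  then have "F (riem_exp M A g p (tangent_scale ((1 / 2) ^ j) v))
      \<le> F p + (\<beta> * (1 / 2) ^ j) *\<^sub>R grad_apply A g F p v"
    using j by (simp add: less_eq_vec_def)
  then have "(1 / 2) ^ j \<in> armijo_steps M A g F \<beta> p v"
    unfolding armijo_steps_def by blast
  then show ?thesis
    by blast
qed

lemma steepest_descent_direction_is_arg_min:
  fixes F :: "'a \<Rightarrow> real ^ 'm::finite"
  assumes "C1_map A F" "p \<in> topspace M"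
  shows "is_arg_min (descent_objective A g F p) (\<lambda>v. v \<in> tangent_space A p)
    (steepest_descent_direction A g F p)"
  unfolding steepest_descent_direction_def arg_min_def
  by (rule someI_ex[OF ex1_implies_ex[OF descent_direction_ex1[OF assms]]])

lemma steepest_descent_direction_in_tangent_space:
  fixes F :: "'a \<Rightarrow> real ^ 'm::finite"
  assumes "C1_map A F" "p \<in> topspace M"
  shows "steepest_descent_direction A g F p \<in> tangent_space A p"
  using steepest_descent_direction_is_arg_min[OF assms] by (simp add: is_arg_min_def)

lemma next_point_in_topspace:
  fixes F :: "'a \<Rightarrow> real ^ 'm::finite"
  assumes "geodesically_complete M A g" "C1_map A F" "p \<in> topspace M"
  shows "next_point M A g F \<beta> p \<in> topspace M"
  unfolding next_point_def Let_def using assms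
  by (intro riem_exp_in_topspace tangent_scale_in_tangent_space
      steepest_descent_direction_in_tangent_space)

lemma iterate_in_topspace:
  fixes F :: "'a \<Rightarrow> real ^ 'm::finite"
  assumes "geodesically_complete M A g" "C1_map A F" "p0 \<in> topspace M"
  shows "iterate M A g F \<beta> p0 k = Some p \<Longrightarrow> p \<in> topspace M"
proof (induction k arbitrary: p)
  case 0
  then show ?case
    using assms(3) by simp
next
  case (Suc k)
  then obtain q where q: "iterate M A g F \<beta> p0 k = Some q" "p = next_point M A g F \<beta> q"
    by (auto split: option.splits if_splits)
  then show ?case
    using next_point_in_topspace[OF assms(1,2) Suc.IH[OF q(1)]] by simp
qed

end

theorem proposition8:
  fixes M :: "'a topology"
    and A :: "('a, 'n::finite) chart set"
    and g :: "('a, 'n) metric"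
    and F :: "'a \<Rightarrow> real ^ 'm::finite"
    and \<beta> :: real
    and p0 :: 'a
  assumes "riemannian_manifold M A g"
    and "connected_space M"
    and "geodesically_complete M A g"
    and "C1_map A F"
    and "0 < \<beta>" and "\<beta> < 1"
    and "p0 \<in> topspace M"
  shows "\<forall>k p. iterate M A g F \<beta> p0 k = Some p \<longrightarrow>
    p \<in> topspace M \<and>
    (\<not> pareto_critical A g F p \<longrightarrow>
      (\<exists>!v. is_arg_min (descent_objective A g F p) (\<lambda>v. v \<in> tangent_space A p) v) \<and>
      (let v = steepest_descent_direction A g F p; S = armijo_steps M A g F \<beta> p v in
        S \<noteq> {} \<and> (\<exists>t\<in>S. \<forall>s\<in>S. s \<le> t)) \<and>
      (\<exists>q\<in>topspace M. iterate M A g F \<beta> p0 (Suc k) = Some q))"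
proof (intro allI impI)
  interpret riemannian_manifold M A g
    by (fact assms(1))
  fix k p
  assume iter: "iterate M A g F \<beta> p0 k = Some p"
  have p: "p \<in> topspace M"
    by (rule iterate_in_topspace[OF assms(3,4,7) iter])
  let ?v = "steepest_descent_direction A g F p"
  have "(\<exists>!v. is_arg_min (descent_objective A g F p) (\<lambda>v. v \<in> tangent_space A p) v) \<and>
      (let v = ?v; S = armijo_steps M A g F \<beta> p v in
        S \<noteq> {} \<and> (\<exists>t\<in>S. \<forall>s\<in>S. s \<le> t)) \<and>
      (\<exists>q\<in>topspace M. iterate M A g F \<beta> p0 (Suc k) = Some q)"
    if noncritical: "\<not> pareto_critical A g F p"
    unfolding Let_def
  proof (intro conjI)
    show "\<exists>!v. is_arg_min (descent_objective A g F p) (\<lambda>v. v \<in> tangent_space A p) v"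
      by (rule descent_direction_ex1[OF assms(4) p])
    have "grad_apply A g F p ?v $ i < 0" for i
      by (rule descent_direction_negative[OF assms(4) p
            steepest_descent_direction_is_arg_min[OF assms(4) p] noncritical])
    then show nonempty: "armijo_steps M A g F \<beta> p ?v \<noteq> {}"
      by (intro armijo_steps_nonempty assms p steepest_descent_direction_in_tangent_space)
    show "\<exists>t\<in>armijo_steps M A g F \<beta> p ?v. \<forall>s\<in>armijo_steps M A g F \<beta> p ?v. s \<le> t"
      using nonempty by (rule armijo_steps_attain_max)
    show "\<exists>q\<in>topspace M. iterate M A g F \<beta> p0 (Suc k) = Some q"
      using next_point_in_topspace[OF assms(3,4) p, of \<beta>] iter noncritical by simp
  qed
  with p show "p \<in> topspace M \<and>
    (\<not> pareto_critical A g F p \<longrightarrow>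
      (\<exists>!v. is_arg_min (descent_objective A g F p) (\<lambda>v. v \<in> tangent_space A p) v) \<and>
      (let v = ?v; S = armijo_steps M A g F \<beta> p v in
        S \<noteq> {} \<and> (\<exists>t\<in>S. \<forall>s\<in>S. s \<le> t)) \<and>
      (\<exists>q\<in>topspace M. iterate M A g F \<beta> p0 (Suc k) = Some q))"
    by blast
qed

end
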